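(* Let $G$ be a Métivier group with structure matrices $U^{(1)},\dots,U^{(m)}$, let $\lambda\in\mathbb R^m\setminus\{0\}$, $p,q\in\mathbb Z_+$ and $r\ge0$. Let $f=\tilde aP$ be a smooth function on $\mathbb C^n$, where $\tilde a=\tilde a(|z|)$ is radial and $P\in H^\lambda_{p,q}$, and suppose that $|z|^ke^{\frac{\mu_{\lambda,1}}{4}|z|^2}f(z)$ is bounded for each $k\in\mathbb Z_+$. Then $$\Pi_{0,0}\left(P_\lambda^{p,q}(\tilde Z)f_\lambda\right)\tilde\times_\lambda\,\mu_s(z)=0\quad\text{for all } z\in\mathbb C^n\text{ and } s>r+|z|$$ if and only if $f$ is supported in $|z|\le r$.
   Context: **Métivier group.** $U^{(1)},\dots,U^{(m)}$ are real skew-symmetric $2n\times2n$ matrices such that $V_\lambda=\sum_{j}\lambda_jU^{(j)}$ is non-singular for every $\lambda\in\mathbb R^m\setminus\{0\}$; the Métivier group is $\mathbb R^{2n}\times\mathbb R^m$ with law $(x,t)(\xi,\tau)=(x+\xi,(t_j+\tau_j+\frac12\langle x,U^{(j)}\xi\rangle)_j)$. Identify $x=(x_1,\dots,x_n,y_1,\dots,y_n)\in\mathbb R^{2n}$ with its complexification $z=(x_1+iy_1,\dots,x_n+iy_n)\in\mathbb C^n$. **The matrix $A_\lambda$ and $f_\lambda$.** Let $\pm i\mu_{\lambda,1},\dots,\pm i\mu_{\lambda,n}$ with $\mu_{\lambda,1}\ge\cdots\ge\mu_{\lambda,n}>0$ be the eigenvalues of $V_\lambda$ with corresponding eigenvectors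 $u_j\pm iv_j$, chosen so that $A_\lambda=(\sqrt2v_1,\dots,\sqrt2v_n,\sqrt2u_1,\dots,\sqrt2u_n)$ is an orthogonal matrix; then $V_\lambda A_\lambda=A_\lambda U_\lambda$ with $U_\lambda=\begin{pmatrix} 0 & -J_\lambda \\ J_\lambda & 0 \end{pmatrix}$, $J_\lambda=\mathrm{diag}(\mu_{\lambda,1},\dots,\mu_{\lambda,n})$. If $z$ is the complexification of $x$, let $\tilde z_\lambda$ be the complexification of $A_\lambda x$, and for a function $f$ on $\mathbb C^n$ put $f_\lambda(z)=f(\tilde z_\lambda)$. **Modified twisted mean.** With $\mu_s$ the normalized surface measure on $\{|w|=s\}\subset\mathbb C^n$, $$g\,\tilde\times_\lambda\,\mu_s(z)=\int_{|w|=s}g(z-w)\,e^{\frac i2\sum_{j=1}^n\mu_{\lambda,j}\mathrm{Im}(z_j\bar w_j)}\,d\mu_s(w).$$ **Harmonic polynomials.** $H_{p,q}$ is the space of harmonic polynomials on $\mathbb C^n$ of the form $\sum_{|\alpha|=p,|\beta|=q}c_{\alpha\beta}z^\alpha\bar z^\beta$. $H^\lambda_{p,q}=\{P\in\bigoplus_{p'+q'=p+q}H_{p',q'}:P_\lambda\in H_{p,q}\}$. $\Pi_{0,0}g$ denotes the projection of $g$ onto radial functions, i.e. $\Pi_{0,0}g(z)$ is the average of $g$ over the sphere of radius $|z|$ centered at $0$. **The operator $P_\lambda^{p,q}(\tilde Z)$.** Let $\tilde Z_j^\lambda=\frac{\partial}{\partial z_j}-\frac{\mu_{\lambda,j}}4\bar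 z_j$ and $\tilde Z_j^{*\lambda}=\frac{\partial}{\partial\bar z_j}+\frac{\mu_{\lambda,j}}4z_j$, $1\le j\le n$. For (nonzero) $P_\lambda\in H_{p,q}$ fix a monomial $z^\alpha\bar z^\beta$, $|\alpha|=p$, $|\beta|=q$, occurring in $P_\lambda$ with non-zero coefficient, and put $$P_\lambda^{p,q}(\tilde Z)=(\tilde Z_1^\lambda)^{\alpha_1}\cdots(\tilde Z_n^\lambda)^{\alpha_n}(\tilde Z_1^{*\lambda})^{\beta_1}\cdots(\tilde Z_n^{*\lambda})^{\beta_n}.$$ *)

theory Defs
  imports "HOL-Analysis.Analysis"
begin

subsection \<open>Metivier groups and the matrix \<open>A\<^sub>\<lambda>\<close>\<close>

text \<open>
  Coordinates of \<open>\<real>\<^sup>2\<^sup>n\<close> are indexed by \<^typ>\<open>'n + 'n\<close>: in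
  \<open>(x\<^sub>1, \<dots>, x\<^sub>n, y\<^sub>1, \<dots>, y\<^sub>n)\<close> the coordinate \<open>x\<^sub>j\<close> has index \<open>Inl j\<close> and \<open>y\<^sub>j\<close> has index
  \<open>Inr j\<close>.
\<close>

definition V_mat :: "('m::finite \<Rightarrow> real^('n::finite + 'n)^('n + 'n)) \<Rightarrow> real^'m
    \<Rightarrow> real^('n + 'n)^('n + 'n)" where
  "V_mat U lam = (\<Sum>j\<in>UNIV. (lam $ j) *\<^sub>R U j)"

text \<open>\<open>metivier_group U G\<close>: the binary operation \<open>G\<close> on \<open>\<real>\<^sup>2\<^sup>n \<times> \<real>\<^sup>m\<close> is the group law of the
  Metivier group with structure matrices \<open>U\<close>.\<close>

definition metivier_group :: "('m::finite \<Rightarrow> real^('n::finite + 'n)^('n + 'n))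
    \<Rightarrow> ((real^('n + 'n)) \<times> (real^'m) \<Rightarrow> (real^('n + 'n)) \<times> (real^'m)
          \<Rightarrow> (real^('n + 'n)) \<times> (real^'m)) \<Rightarrow> bool" where
  "metivier_group U G \<longleftrightarrow>
     (\<forall>j. transpose (U j) = - U j) \<and>
     (\<forall>lam. lam \<noteq> 0 \<longrightarrow> invertible (V_mat U lam)) \<and>
     G = (\<lambda>(x, t) (xi, tau).
            (x + xi, \<chi> j. t $ j + tau $ j + (1 / 2) * (x \<bullet> (U j *v xi))))"

text \<open>\<open>w \<noteq> 0\<close> is an eigenvector of the real matrix \<open>V\<close> for the complex eigenvalue \<open>c\<close>.\<close>

definition complex_eigenvector :: "real^'k^'k \<Rightarrow> complex \<Rightarrow> complex^'k \<Rightarrow> bool" where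
  "complex_eigenvector V c w \<longleftrightarrow>
     w \<noteq> 0 \<and> (\<chi> i j. complex_of_real (V $ i $ j)) *v w = c *s w"

definition frame_matrix :: "('n::finite \<Rightarrow> real^('n + 'n)) \<Rightarrow> ('n \<Rightarrow> real^('n + 'n))
    \<Rightarrow> real^('n + 'n)^('n + 'n)" where
  "frame_matrix u v =
     (\<chi> i k. case k of Inl j \<Rightarrow> sqrt 2 * v j $ i | Inr j \<Rightarrow> sqrt 2 * u j $ i)"

text \<open>
  \<open>A\<close> is an admissible choice of \<open>A\<^sub>\<lambda>\<close> for the skew-symmetric matrix \<open>V = V\<^sub>\<lambda>\<close>. As the columns of
  \<open>A\<close> form a basis, the eigenvalues \<open>\<plusminus>\<i> mu j\<close> are all the eigenvalues of \<open>V\<close>, counted with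
  multiplicity; they are listed in decreasing order along the linear order of the index type.
\<close>

definition eigenframe :: "real^('n::{finite,linorder} + 'n)^('n + 'n) \<Rightarrow> ('n \<Rightarrow> real)
    \<Rightarrow> real^('n + 'n)^('n + 'n) \<Rightarrow> bool" where
  "eigenframe V mu A \<longleftrightarrow>
     antimono mu \<and> (\<forall>j. mu j > 0) \<and>
     (\<exists>u v. (\<forall>j. complex_eigenvector V (\<i> * mu j) (\<chi> k. Complex (u j $ k) (v j $ k)) \<and>
                  complex_eigenvector V (- \<i> * mu j) (\<chi> k. Complex (u j $ k) (- v j $ k))) \<and>
            A = frame_matrix u v \<and> orthogonal_matrix A)"

definition complexify :: "real^('n::finite + 'n) \<Rightarrow> complex^'n" where
  "complexify x = (\<chi> j. Complex (x $ Inl j) (x $ Inr j))"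

definition realify :: "complex^'n::finite \<Rightarrow> real^('n + 'n)" where
  "realify z = (\<chi> k. case k of Inl j \<Rightarrow> Re (z $ j) | Inr j \<Rightarrow> Im (z $ j))"

text \<open>\<open>f\<^sub>\<lambda>(z) = f(z\<^sub>\<lambda>)\<close>, where \<open>z\<^sub>\<lambda>\<close> is the complexification of \<open>A\<^sub>\<lambda> x\<close>.\<close>

definition twist :: "real^('n::finite + 'n)^('n + 'n) \<Rightarrow> (complex^'n \<Rightarrow> complex)
    \<Rightarrow> complex^'n \<Rightarrow> complex" where
  "twist A f z = f (complexify (A *v realify z))"


subsection \<open>Derivatives, smooth functions, harmonic polynomials\<close>

abbreviation dir_deriv :: "'a::real_normed_vector \<Rightarrow> ('a \<Rightarrow> complex) \<Rightarrow> 'a \<Rightarrow> complex" where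
  "dir_deriv b f z \<equiv> frechet_derivative f (at z) b"

fun Ck :: "nat \<Rightarrow> ('a::euclidean_space \<Rightarrow> complex) \<Rightarrow> bool" where
  "Ck 0 f \<longleftrightarrow> continuous_on UNIV f"
| "Ck (Suc k) f \<longleftrightarrow> (\<forall>x. f differentiable (at x)) \<and> (\<forall>b\<in>Basis. Ck k (dir_deriv b f))"

definition smooth :: "('a::euclidean_space \<Rightarrow> complex) \<Rightarrow> bool" where
  "smooth f \<longleftrightarrow> (\<forall>k. Ck k f)"

definition laplacian :: "('a::euclidean_space \<Rightarrow> complex) \<Rightarrow> 'a \<Rightarrow> complex" where
  "laplacian f z = (\<Sum>b\<in>Basis. dir_deriv b (dir_deriv b f) z)"

definition d_z :: "'n::finite \<Rightarrow> (complex^'n \<Rightarrow> complex) \<Rightarrow> complex^'n \<Rightarrow> complex" where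
  "d_z j f z = (dir_deriv (axis j 1) f z - \<i> * dir_deriv (axis j \<i>) f z) / 2"

definition d_zbar :: "'n::finite \<Rightarrow> (complex^'n \<Rightarrow> complex) \<Rightarrow> complex^'n \<Rightarrow> complex" where
  "d_zbar j f z = (dir_deriv (axis j 1) f z + \<i> * dir_deriv (axis j \<i>) f z) / 2"

definition multi_indices :: "nat \<Rightarrow> ('n::finite \<Rightarrow> nat) set" where
  "multi_indices p = {\<alpha>. (\<Sum>j\<in>UNIV. \<alpha> j) = p}"

definition bihom_poly :: "nat \<Rightarrow> nat \<Rightarrow> (('n::finite \<Rightarrow> nat) \<Rightarrow> ('n \<Rightarrow> nat) \<Rightarrow> complex)
    \<Rightarrow> complex^'n \<Rightarrow> complex" where
  "bihom_poly p q c z =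
     (\<Sum>\<alpha>\<in>multi_indices p. \<Sum>\<beta>\<in>multi_indices q.
        c \<alpha> \<beta> * (\<Prod>j\<in>UNIV. z $ j ^ \<alpha> j) * (\<Prod>j\<in>UNIV. cnj (z $ j) ^ \<beta> j))"

definition H_space :: "nat \<Rightarrow> nat \<Rightarrow> (complex^'n::finite \<Rightarrow> complex) set" where
  "H_space p q = {P. (\<exists>c. P = bihom_poly p q c) \<and> (\<forall>z. laplacian P z = 0)}"

definition H_lam_space :: "real^('n::finite + 'n)^('n + 'n) \<Rightarrow> nat \<Rightarrow> nat
    \<Rightarrow> (complex^'n \<Rightarrow> complex) set" where
  "H_lam_space A p q =
     {P. (\<exists>h. (\<forall>k\<le>p + q. h k \<in> H_space k (p + q - k)) \<and> P = (\<lambda>z. \<Sum>k\<le>p + q. h k z)) \<and>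
         twist A P \<in> H_space p q}"

text \<open>The monomial with exponents \<open>\<alpha>\<close>, \<open>\<beta>\<close> occurs in \<open>Q\<close> with non-zero coefficient; the
  coefficients of a polynomial function are unique.\<close>

definition occurs_in :: "nat \<Rightarrow> nat \<Rightarrow> (complex^'n::finite \<Rightarrow> complex)
    \<Rightarrow> ('n \<Rightarrow> nat) \<Rightarrow> ('n \<Rightarrow> nat) \<Rightarrow> bool" where
  "occurs_in p q Q \<alpha> \<beta> \<longleftrightarrow>
     \<alpha> \<in> multi_indices p \<and> \<beta> \<in> multi_indices q \<and> (\<exists>c. Q = bihom_poly p q c \<and> c \<alpha> \<beta> \<noteq> 0)"


subsection \<open>The operator \<open>P\<^sub>\<lambda>\<^sup>p\<^sup>,\<^sup>q(Z)\<close>\<close>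

definition Z_op :: "('n::finite \<Rightarrow> real) \<Rightarrow> 'n \<Rightarrow> (complex^'n \<Rightarrow> complex) \<Rightarrow> complex^'n \<Rightarrow> complex"
  where "Z_op mu j f z = d_z j f z - of_real (mu j / 4) * cnj (z $ j) * f z"

definition Zstar_op :: "('n::finite \<Rightarrow> real) \<Rightarrow> 'n \<Rightarrow> (complex^'n \<Rightarrow> complex) \<Rightarrow> complex^'n \<Rightarrow> complex"
  where "Zstar_op mu j f z = d_zbar j f z + of_real (mu j / 4) * (z $ j) * f z"

text \<open>The factors are composed in increasing order of the index, all \<open>Z\<^sub>j\<close> to the left of all
  \<open>Z\<^sup>*\<^sub>j\<close>, so that the latter act first.\<close>

definition P_op :: "('n::{finite,linorder} \<Rightarrow> real) \<Rightarrow> ('n \<Rightarrow> nat) \<Rightarrow> ('n \<Rightarrow> nat)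
    \<Rightarrow> (complex^('n::{finite,linorder}) \<Rightarrow> complex) \<Rightarrow> complex^('n::{finite,linorder}) \<Rightarrow> complex" where
  "P_op mu \<alpha> \<beta> f =
     foldr (\<lambda>j. Z_op mu j ^^ \<alpha> j) (sorted_list_of_set UNIV)
       (foldr (\<lambda>j. Zstar_op mu j ^^ \<beta> j) (sorted_list_of_set UNIV) f)"


subsection \<open>Spherical means\<close>

text \<open>
  The normalized surface measure on the sphere of radius \<open>s\<close> centred at the origin, as the cone
  measure: a set \<open>E\<close> of directions has mass proportional to the Lebesgue measure of the part of
  the unit ball lying over \<open>E\<close>. For \<open>s = 0\<close> it is the point mass at the origin.
\<close>

definition sphere_measure :: "real \<Rightarrow> 'a::euclidean_space measure" where
  "sphere_measure s =
     distr (uniform_measure lborel (ball 0 1)) borel (\<lambda>x. (s / norm x) *\<^sub>R x)"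

definition Pi00 :: "(complex^'n::finite \<Rightarrow> complex) \<Rightarrow> complex^'n \<Rightarrow> complex" where
  "Pi00 g z = (LINT w|sphere_measure (norm z). g w)"

definition twisted_mean :: "('n::finite \<Rightarrow> real) \<Rightarrow> (complex^'n \<Rightarrow> complex) \<Rightarrow> real
    \<Rightarrow> complex^'n \<Rightarrow> complex" where
  "twisted_mean mu g s z =
     (LINT w|sphere_measure s.
        g (z - w) * exp (\<i> / 2 * of_real (\<Sum>j\<in>UNIV. mu j * Im (z $ j * cnj (w $ j)))))"

end

theory Submission
  imports Defs
begin

text \<open>Put \<open>Q = twist A P\<close>, a harmonic polynomial of degree \<open>N = p + q\<close> on \<open>\<complex>\<^sup>n\<close>. As \<open>A\<close> is orthogonal,
  \<open>twist A f\<close> is \<open>\<phi> (\<bar>z\<bar>\<^sup>2) Q z\<close>. If \<open>Q = 0\<close>, then \<open>f = 0\<close> and both sides hold; otherwise the profile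
  \<open>\<phi>\<close> is smooth on the open half-line.

  At the centre \<open>z = 0\<close> the exponential factor of the twisted mean is \<open>1\<close>, so the twisted mean of a
  radial function over the sphere of radius \<open>s\<close> is the value of that function at radius \<open>s\<close>. The
  left-hand condition therefore says that \<open>Pi00 (P_op mu \<alpha> \<beta> (twist A f))\<close> vanishes outside the ball
  of radius \<open>r\<close>: one direction is the case \<open>z = 0\<close>, and for the other \<open>\<bar>z - w\<bar> > r\<close> whenever
  \<open>\<bar>w\<bar> = s > r + \<bar>z\<bar>\<close>. What remains is a statement about the profile \<open>\<phi>\<close>.

  The projection can be computed exactly. Let \<open>c\<^sub>1, \<dots>, c\<^sub>N\<close> be the constants \<open>\<plusminus> \<mu>\<^sub>j / 4\<close> that belong to
  the factors of the operator. With \<open>t = \<bar>z\<bar>\<^sup>2\<close>,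
  \<open>t\<^sup>n\<^sup>-\<^sup>1 Pi00 (\<dots>) = \<kappa> (d/dt + c\<^sub>1) \<cdots> (d/dt + c\<^sub>N) (t\<^sup>n\<^sup>-\<^sup>1\<^sup>+\<^sup>N \<phi> t)\<close>,
  where \<open>\<kappa>\<close> is the mean over the unit sphere of \<open>Q\<close> times the conjugate of the monomial with exponents
  \<open>\<alpha>\<close>, \<open>\<beta>\<close>; this is \<open>sphere_mean_twisted_derivs\<close>. Everything in it follows from one identity,
  \<open>unit_mean_wirt\<close>: integration by parts on the sphere, which is the infinitesimal form of rotation
  invariance. The same identity moves the monomial from one factor of \<open>\<kappa>\<close> onto the other as a
  differential operator, so that \<open>\<kappa>\<close> is a non-zero multiple of the coefficient of that monomial in \<open>Q\<close>
  (\<open>unit_mean_symbol_nonzero\<close>, \<open>occurs_in_foldr_wirt\<close>).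

  Hence \<open>w t = t\<^sup>n\<^sup>-\<^sup>1\<^sup>+\<^sup>N \<phi> t\<close> solves a linear differential equation with constant coefficients for
  \<open>t > r\<^sup>2\<close>. Its solutions are combinations of \<open>t\<^sup>k exp (- c\<^sub>i t)\<close>, none of which decays faster than
  \<open>exp (- \<mu>\<^sub>1 t / 4)\<close>, whereas the bounds on \<open>f\<close> force \<open>w\<close> to decay faster. So \<open>\<phi>\<close> vanishes there
  (\<open>decaying_solution_zero\<close>), and with it \<open>f\<close> outside the ball.\<close>

section \<open>Rotation invariance of the sphere measure\<close>

lemma nn_integral_lborel_translation:
  fixes g :: "'a::euclidean_space \<Rightarrow> ennreal"
  assumes [measurable]: "g \<in> borel_measurable borel"
  shows "(\<integral>\<^sup>+x. g (c + x) \<partial>lborel) = (\<integral>\<^sup>+x. g x \<partial>lborel)"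
proof -
  have "(\<integral>\<^sup>+x. g x \<partial>lborel) = (\<integral>\<^sup>+x. g x \<partial>distr lborel borel ((+) c))"
    by (simp only: lborel_distr_plus)
  also have "\<dots> = (\<integral>\<^sup>+x. g (c + x) \<partial>lborel)"
    by (subst nn_integral_distr) auto
  finally show ?thesis by simp
qed

lemma emeasure_lborel_unit_ball:
  fixes y :: "'a::euclidean_space"
  shows "emeasure lborel (ball y 1) = emeasure lborel (ball (0::'a) 1)"
    and "emeasure lborel (ball y 1) \<noteq> 0" and "emeasure lborel (ball y 1) \<noteq> \<infinity>"
proof -
  have "(\<integral>\<^sup>+x. indicator (ball y 1) (y + x) \<partial>lborel) = (\<integral>\<^sup>+x. indicator (ball y 1) x \<partial>lborel)"
    by (rule nn_integral_lborel_translation) (intro borel_measurable_indicator borel_open open_ball)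
  moreover have "indicator (ball y 1) (y + x) = (indicator (ball 0 1) x :: ennreal)" for x
    by (auto simp: indicator_def dist_norm)
  ultimately show "emeasure lborel (ball y 1) = emeasure lborel (ball (0::'a) 1)" by simp
  show "emeasure lborel (ball y 1) \<noteq> \<infinity>"
    using emeasure_bounded_finite[of "ball y 1"] by auto
  show "emeasure lborel (ball y 1) \<noteq> 0"
    using open_not_negligible[of "ball y 1"]
    by (auto simp: negligible_iff_null_sets null_sets_def)
qed

text \<open>Haar uniqueness in miniature. Computing the double integral of \<open>indicator (ball 0 1) y * indicator E (f y + x)\<close>
  in both orders, with translation invariance in each variable, gives \<open>lborel E * vol = lborel (f -` E) * vol\<close>
  with the volume \<open>vol\<close> of the unit ball, because \<open>f\<close> maps balls to balls.\<close>

lemma lborel_orthogonal_transformation: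
  fixes f :: "'a::euclidean_space \<Rightarrow> 'a"
  assumes f: "orthogonal_transformation f"
  shows "distr lborel borel f = lborel"
proof (rule measure_eqI)
  show "sets (distr lborel borel f) = sets lborel" by simp
  fix E assume "E \<in> sets (distr lborel borel f)"
  then have E[measurable]: "E \<in> sets borel" by simp
  have lin: "linear f" and nrm: "\<And>x. norm (f x) = norm x"
    using f by (auto simp: orthogonal_transformation)
  have [measurable]: "f \<in> borel_measurable borel"
    using lin by (intro borel_measurable_continuous_onI) (simp add: linear_continuous_on linear_linear)
  let ?B = "ball (0::'a) 1"
  let ?m = "emeasure lborel ?B"
  have B: "?B \<in> sets borel" by (simp add: borel_open)
  have fs: "(\<lambda>p. f (snd p)) \<in> borel_measurable (lborel \<Otimes>\<^sub>M lborel)"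
    by (rule measurable_compose[OF measurable_snd]) simp
  have fst': "fst \<in> borel_measurable (lborel \<Otimes>\<^sub>M (lborel :: 'a measure))"
    using measurable_fst[of lborel lborel] by simp
  note ind = measurable_compose[OF _ borel_measurable_indicator]
  have m1: "(\<lambda>(x, y). indicator ?B y * indicator E (f y + x) :: ennreal)
      \<in> borel_measurable (lborel \<Otimes>\<^sub>M lborel)"
    unfolding case_prod_beta' using measurable_snd[of lborel "lborel :: 'a measure"]
    by (intro borel_measurable_times_ennreal ind[OF _ B] ind[OF _ E] borel_measurable_add fs fst') simp
  have m2: "(\<lambda>(x, y). indicator ?B (f y - x) * indicator E (f y) :: ennreal)
      \<in> borel_measurable (lborel \<Otimes>\<^sub>M lborel)"
    unfolding case_prod_beta'
    by (intro borel_measurable_times_ennreal ind[OF _ B] ind[OF _ E] borel_measurable_diff fs fst')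
  have inv: "f (inv f x) = x" for x
    using orthogonal_transformation_surj[OF f] by (simp add: surj_f_inv_f)
  have "emeasure lborel E * ?m = (\<integral>\<^sup>+y. indicator ?B y * (\<integral>\<^sup>+x. indicator E x \<partial>lborel) \<partial>lborel)"
    by (subst nn_integral_multc)
      (auto simp: mult.commute intro!: borel_measurable_indicator borel_open)
  also have "\<dots> = (\<integral>\<^sup>+y. (\<integral>\<^sup>+x. indicator ?B y * indicator E (f y + x) \<partial>lborel) \<partial>lborel)"
  proof (rule nn_integral_cong)
    fix y
    have "(\<integral>\<^sup>+x. indicator E x \<partial>lborel) = (\<integral>\<^sup>+x. indicator E (f y + x) \<partial>lborel)"
      by (rule nn_integral_lborel_translation[symmetric]) measurable
    then show "indicator ?B y * (\<integral>\<^sup>+x. indicator E x \<partial>lborel)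
        = (\<integral>\<^sup>+x. indicator ?B y * indicator E (f y + x) \<partial>lborel)"
      by (simp add: nn_integral_cmult)
  qed
  also have "\<dots> = (\<integral>\<^sup>+x. (\<integral>\<^sup>+y. indicator ?B y * indicator E (f y + x) \<partial>lborel) \<partial>lborel)"
    by (rule lborel_pair.Fubini'[OF m1])
  also have "\<dots> = (\<integral>\<^sup>+x. (\<integral>\<^sup>+y. indicator ?B (inv f (- x) + y) * indicator E (f y) \<partial>lborel) \<partial>lborel)"
  proof (rule nn_integral_cong)
    fix x
    have "(\<integral>\<^sup>+y. indicator ?B y * indicator E (f y + x) \<partial>lborel)
        = (\<integral>\<^sup>+y. indicator ?B (inv f (- x) + y) * indicator E (f (inv f (- x) + y) + x) \<partial>lborel)"
      by (rule nn_integral_lborel_translation[symmetric])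
         (intro borel_measurable_times_ennreal ind[OF _ B] ind[OF _ E] borel_measurable_add, simp_all)
    then show "(\<integral>\<^sup>+y. indicator ?B y * indicator E (f y + x) \<partial>lborel)
        = (\<integral>\<^sup>+y. indicator ?B (inv f (- x) + y) * indicator E (f y) \<partial>lborel)"
      by (simp add: linear_add[OF lin] inv)
  qed
  also have "\<dots> = (\<integral>\<^sup>+x. (\<integral>\<^sup>+y. indicator ?B (f y - x) * indicator E (f y) \<partial>lborel) \<partial>lborel)"
  proof -
    have "norm (inv f (- x) + y) = norm (f y - x)" for x y
    proof -
      have "f (inv f (- x) + y) = f y - x"
        by (simp only: linear_add[OF lin] inv) simp
      then show ?thesis using nrm[of "inv f (- x) + y"] by simp
    qed
    then show ?thesis by (simp add: indicator_def)
  qed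
  also have "\<dots> = (\<integral>\<^sup>+y. (\<integral>\<^sup>+x. indicator ?B (f y - x) * indicator E (f y) \<partial>lborel) \<partial>lborel)"
    by (rule lborel_pair.Fubini'[OF m2, symmetric])
  also have "\<dots> = (\<integral>\<^sup>+y. (\<integral>\<^sup>+x. indicator (ball (f y) 1) x \<partial>lborel) * indicator E (f y) \<partial>lborel)"
  proof -
    have "indicator ?B (f y - x) = (indicator (ball (f y) 1) x :: ennreal)" for x y
      by (simp add: indicator_def dist_norm norm_minus_commute)
    moreover have "(\<integral>\<^sup>+x. indicator (ball (f y) 1) x * indicator E (f y) \<partial>lborel)
        = (\<integral>\<^sup>+x. indicator (ball (f y) 1) x \<partial>lborel) * (indicator E (f y) :: ennreal)" for y
      by (rule nn_integral_multc) (simp add: borel_measurable_indicator borel_open)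
    ultimately show ?thesis by presburger
  qed
  also have "\<dots> = ?m * (\<integral>\<^sup>+y. indicator E (f y) \<partial>lborel)"
  proof -
    have "(\<integral>\<^sup>+x. indicator (ball (f y) 1) x \<partial>lborel) = ?m" for y
      using emeasure_lborel_unit_ball(1)[of "f y"] by simp
    then show ?thesis by (simp add: nn_integral_cmult)
  qed
  also have "(\<integral>\<^sup>+y. indicator E (f y) \<partial>lborel) = emeasure (distr lborel borel f) E"
    using nn_integral_distr[of f lborel borel "indicator E"] by simp
  finally show "emeasure (distr lborel borel f) E = emeasure lborel E"
    using emeasure_lborel_unit_ball(2,3)[of "0::'a"]
    by (simp add: mult.commute[of _ ?m] ennreal_mult_cancel_left)
qed

abbreviation unit_ball_prob :: "'a::euclidean_space measure" where
  "unit_ball_prob \<equiv> uniform_measure lborel (ball 0 1)"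

lemma finite_unit_ball_prob: "finite_measure (unit_ball_prob :: 'a::euclidean_space measure)"
  by (rule finite_measureI)
     (use emeasure_lborel_unit_ball(2,3)[of "0::'a"] in
       \<open>simp add: emeasure_uniform_measure_1 ennreal_divide_self top.not_eq_extremum\<close>)

lemma measure_unit_ball_prob: "measure (unit_ball_prob :: 'a::euclidean_space measure) UNIV = 1"
  using emeasure_lborel_unit_ball(2,3)[of "0::'a"]
  by (simp add: measure_def ennreal_divide_self top.not_eq_extremum)

lemma measurable_radial_scale [measurable]:
  "(\<lambda>x::'a::euclidean_space. (s / norm x) *\<^sub>R x) \<in> borel_measurable borel"
  by measurable

lemma AE_unit_ball_nonzero: "AE x in (unit_ball_prob :: 'a::euclidean_space measure). x \<noteq> 0"
  by (rule AE_uniform_measureI) (auto intro!: AE_I[where N="{0}"])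

lemma finite_sphere_measure: "finite_measure (sphere_measure s :: 'a::euclidean_space measure)"
  unfolding sphere_measure_def using finite_unit_ball_prob by (intro finite_measure.finite_measure_distr) auto

lemma sets_sphere_measure [simp, measurable_cong]: "sets (sphere_measure s) = sets borel"
  and space_sphere_measure [simp]: "space (sphere_measure s) = UNIV"
  by (simp_all add: sphere_measure_def)

lemma measure_sphere_measure_UNIV: "measure (sphere_measure s :: 'a::euclidean_space measure) UNIV = 1"
  unfolding sphere_measure_def by (subst measure_distr) (auto simp: measure_unit_ball_prob)

lemma AE_sphere_measure_norm:
  assumes "s \<ge> 0"
  shows "AE w in (sphere_measure s :: 'a::euclidean_space measure). norm w = s"
  unfolding sphere_measure_def
proof (subst AE_distr_iff)
  show "AE x in (unit_ball_prob :: 'a measure). norm ((s / norm x) *\<^sub>R x) = s"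
    using AE_unit_ball_nonzero by eventually_elim (use assms in auto)
qed auto

lemma sphere_measure_scale:
  assumes "s \<ge> 0"
  shows "(sphere_measure s :: 'a::euclidean_space measure) = distr (sphere_measure 1) borel (\<lambda>x. s *\<^sub>R x)"
  unfolding sphere_measure_def by (subst distr_distr) (auto simp: o_def)

text \<open>An isometry fixing the origin commutes with the radial projection and preserves the uniform
  distribution on the unit ball, from which the sphere measure is obtained.\<close>

lemma sphere_measure_orthogonal_transformation:
  fixes f :: "'a::euclidean_space \<Rightarrow> 'a"
  assumes f: "orthogonal_transformation f"
  shows "distr (sphere_measure 1) borel f = sphere_measure 1"
proof -
  have lin: "linear f" and nrm: "\<And>x. norm (f x) = norm x"
    using f by (auto simp: orthogonal_transformation)
  have [measurable]: "f \<in> borel_measurable borel"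
    using lin by (intro borel_measurable_continuous_onI) (simp add: linear_continuous_on linear_linear)
  let ?u = "unit_ball_prob :: 'a measure"
  have ball: "f -` ball 0 1 = ball 0 1"
    by (auto simp: nrm)
  have u: "distr ?u borel f = ?u"
  proof (rule measure_eqI)
    fix E assume "E \<in> sets (distr ?u borel f)"
    then have E[measurable]: "E \<in> sets borel" by simp
    have "emeasure (distr ?u borel f) E = emeasure ?u (f -` E)"
      by (subst emeasure_distr) auto
    also have "\<dots> = emeasure lborel (f -` (ball 0 1 \<inter> E)) / emeasure lborel (ball (0::'a) 1)"
      by (subst emeasure_uniform_measure) (auto simp: ball measurable_sets_borel[of f borel])
    also have "emeasure lborel (f -` (ball 0 1 \<inter> E)) = emeasure (distr lborel borel f) (ball 0 1 \<inter> E)"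
      by (subst emeasure_distr) auto
    also have "distr lborel borel f = lborel"
      by (rule lborel_orthogonal_transformation[OF f])
    finally show "emeasure (distr ?u borel f) E = emeasure ?u E" by simp
  qed simp
  have "distr (sphere_measure 1) borel f = distr ?u borel (f \<circ> (\<lambda>x. (1 / norm x) *\<^sub>R x))"
    unfolding sphere_measure_def by (subst distr_distr) auto
  also have "f \<circ> (\<lambda>x. (1 / norm x) *\<^sub>R x) = (\<lambda>x. (1 / norm x) *\<^sub>R x) \<circ> f"
    by (auto simp: fun_eq_iff nrm linear_scale[OF lin])
  also have "distr ?u borel \<dots> = distr (distr ?u borel f) borel (\<lambda>x. (1 / norm x) *\<^sub>R x)"
    by (subst distr_distr) auto
  also have "\<dots> = sphere_measure 1" unfolding u sphere_measure_def ..
  finally show ?thesis .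
qed

section \<open>Homogeneous polynomials in \<open>z\<close> and its conjugate\<close>

text \<open>The \<open>2 n\<close> functions \<open>z\<^sub>j\<close> and their conjugates, treated as independent coordinates on an equal
  footing. The two families \<open>Z_op\<close> and \<open>Zstar_op\<close> then become a single one, and identities proved
  for one index cover both Wirtinger derivatives.\<close>

definition zeta :: "'n + 'n \<Rightarrow> complex^'n::finite \<Rightarrow> complex" where
  "zeta i z = (case i of Inl j \<Rightarrow> z $ j | Inr j \<Rightarrow> cnj (z $ j))"

definition conj_index :: "'n + 'n \<Rightarrow> 'n + 'n" where
  "conj_index i = (case i of Inl j \<Rightarrow> Inr j | Inr j \<Rightarrow> Inl j)"

definition wirt :: "'n + 'n \<Rightarrow> (complex^'n::finite \<Rightarrow> complex) \<Rightarrow> complex^'n \<Rightarrow> complex" where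
  "wirt i f = (case i of Inl j \<Rightarrow> d_z j f | Inr j \<Rightarrow> d_zbar j f)"

lemma conj_index_conj_index [simp]: "conj_index (conj_index i) = i"
  by (simp add: conj_index_def split: sum.splits)

lemma sum_UNIV_sum:
  fixes g :: "'a::finite + 'b::finite \<Rightarrow> 'c::comm_monoid_add"
  shows "(\<Sum>i\<in>UNIV. g i) = (\<Sum>j\<in>UNIV. g (Inl j)) + (\<Sum>j\<in>UNIV. g (Inr j))"
  using sum.Plus[of UNIV UNIV g] by (simp add: o_def)

lemma sum_Basis_complex_vec:
  fixes g :: "complex^'n::finite \<Rightarrow> 'c::comm_monoid_add"
  shows "(\<Sum>b\<in>Basis. g b) = (\<Sum>j\<in>UNIV. g (axis j 1) + g (axis j \<i>))"
proof -
  have "(Basis :: (complex^'n) set) = (\<Union>j\<in>UNIV. {axis j 1, axis j \<i>})"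
    by (auto simp: Basis_vec_def Basis_complex_def)
  also have "(\<Sum>b\<in>\<dots>. g b) = (\<Sum>j\<in>UNIV. \<Sum>b\<in>{axis j 1, axis j \<i>}. g b)"
    by (rule sum.UNION_disjoint) (auto simp: axis_eq_axis)
  finally show ?thesis by (simp add: axis_eq_axis)
qed

lemma linear_zeta: "linear (zeta i)"
  by (rule linearI) (auto simp: zeta_def complex_eq_iff split: sum.splits)

lemma bounded_linear_zeta: "bounded_linear (zeta i)"
  using linear_zeta linear_conv_bounded_linear by blast

lemma zeta_norm_le: "norm (zeta i z) \<le> norm z"
  by (auto simp: zeta_def Finite_Cartesian_Product.norm_nth_le split: sum.splits)

text \<open>In these coordinates \<open>\<bar>z\<bar>\<^sup>2\<close> is a quadratic form that pairs \<open>i\<close> with \<open>conj_index i\<close>; the factor \<open>2\<close>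
  appears because both members of each pair are summed.\<close>

lemma sum_zeta_conj_index: "(\<Sum>i\<in>UNIV. zeta i z * zeta (conj_index i) z) = 2 * complex_of_real ((norm z)\<^sup>2)"
proof -
  have "complex_of_real ((norm z)\<^sup>2) = (\<Sum>j\<in>UNIV. z $ j * cnj (z $ j))"
    by (simp add: norm_vec_def L2_set_def sum_nonneg flip: complex_norm_square)
  then show ?thesis
    by (simp add: sum_UNIV_sum zeta_def conj_index_def mult.commute)
qed

lemma wirt_has_derivative:
  assumes "(f has_derivative f') (at z)"
  shows "wirt i f z = (case i of Inl j \<Rightarrow> (f' (axis j 1) - \<i> * f' (axis j \<i>)) / 2
                             | Inr j \<Rightarrow> (f' (axis j 1) + \<i> * f' (axis j \<i>)) / 2)"
  using frechet_derivative_at[OF assms]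
  by (simp add: wirt_def d_z_def d_zbar_def split: sum.splits)

lemma wirt_const [simp]: "wirt i (\<lambda>z. c) z = 0"
  by (subst wirt_has_derivative[OF has_derivative_const]) (simp split: sum.splits)

lemma wirt_zeta: "wirt i (zeta k) z = of_bool (i = k)"
  by (subst wirt_has_derivative[OF bounded_linear_imp_has_derivative[OF bounded_linear_zeta]])
     (auto simp: zeta_def axis_def split: sum.splits)

lemma wirt_add:
  assumes "f differentiable (at z)" "g differentiable (at z)"
  shows "wirt i (\<lambda>z. f z + g z) z = wirt i f z + wirt i g z"
proof -
  obtain f' g' where d: "(f has_derivative f') (at z)" "(g has_derivative g') (at z)"
    using assms by (auto simp: differentiable_def)
  show ?thesis
    unfolding wirt_has_derivative[OF d(1)] wirt_has_derivative[OF d(2)]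
      wirt_has_derivative[OF has_derivative_add[OF d]]
    by (auto simp: field_simps split: sum.splits)
qed

lemma wirt_mult:
  assumes "f differentiable (at z)" "g differentiable (at z)"
  shows "wirt i (\<lambda>z. f z * g z) z = wirt i f z * g z + f z * wirt i g z"
proof -
  obtain f' g' where d: "(f has_derivative f') (at z)" "(g has_derivative g') (at z)"
    using assms by (auto simp: differentiable_def)
  show ?thesis
    unfolding wirt_has_derivative[OF d(1)] wirt_has_derivative[OF d(2)]
      wirt_has_derivative[OF has_derivative_mult[OF d]]
    by (auto simp: field_simps split: sum.splits)
qed

lemma wirt_cong_open:
  assumes "open S" "z \<in> S" "\<And>w. w \<in> S \<Longrightarrow> f w = g w"
  shows "wirt i f z = wirt i g z"
proof -
  have "(f has_derivative f') (at z) \<longleftrightarrow> (g has_derivative f') (at z)" for f'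
    using has_derivative_transform_within_open[OF _ assms(1,2)] assms(3) by metis
  then have "frechet_derivative f (at z) = frechet_derivative g (at z)"
    by (simp add: frechet_derivative_def)
  then show ?thesis
    by (simp add: wirt_def d_z_def d_zbar_def split: sum.splits)
qed

lemma has_derivative_radial:
  fixes z :: "complex^'n::finite"
  assumes "(\<phi> has_vector_derivative \<phi>') (at ((norm z)\<^sup>2))"
  shows "((\<lambda>z. \<phi> ((norm z)\<^sup>2)) has_derivative (\<lambda>v. (2 * (z \<bullet> v)) *\<^sub>R \<phi>')) (at z)"
proof -
  have "((\<lambda>z::complex^'n. (norm z)\<^sup>2) has_derivative (\<lambda>v. 2 * (z \<bullet> v))) (at z)"
    unfolding power2_norm_eq_inner by (auto intro!: derivative_eq_intros simp: inner_commute)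
  from has_derivative_compose[OF this, of \<phi> "\<lambda>h. h *\<^sub>R \<phi>'"] assms show ?thesis
    by (simp add: has_vector_derivative_def)
qed

text \<open>On a radial factor, differentiating in one coordinate multiplies by the conjugate coordinate. This
  is why the zero-order part of \<open>Z_op\<close> and \<open>Zstar_op\<close>, which multiplies by the same coordinate,
  merely shifts the derivative of the profile.\<close>

lemma wirt_radial:
  assumes "(\<phi> has_vector_derivative \<phi>') (at ((norm z)\<^sup>2))"
  shows "wirt i (\<lambda>z. \<phi> ((norm z)\<^sup>2)) z = \<phi>' * zeta (conj_index i) z"
  unfolding wirt_has_derivative[OF has_derivative_radial[OF assms]]
  by (auto simp: inner_axis zeta_def conj_index_def inner_complex_def scaleR_conv_of_real
        complex_eq_iff field_simps split: sum.splits)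


text \<open>Homogeneous polynomials as functions, of total degree counted in \<open>z\<close> and its conjugate together.
  The rules build a polynomial one coordinate factor at a time, which is the induction along which
  integration by parts lowers degrees. The zero function has every degree.\<close>

inductive hpoly :: "nat \<Rightarrow> (complex^'n::finite \<Rightarrow> complex) \<Rightarrow> bool" where
  hpoly_const: "hpoly 0 (\<lambda>z. c)"
| hpoly_zeta: "hpoly M G \<Longrightarrow> hpoly (Suc M) (\<lambda>z. zeta i z * G z)"
| hpoly_add: "hpoly M G \<Longrightarrow> hpoly M H \<Longrightarrow> hpoly M (\<lambda>z. G z + H z)"

lemma hpoly_zero: "hpoly M (\<lambda>z. 0)"
proof (induction M)
  case (Suc M)
  from hpoly_zeta[OF Suc, of "undefined"] show ?case by simp
qed (rule hpoly_const)

lemma hpoly_cmult: "hpoly M G \<Longrightarrow> hpoly M (\<lambda>z. c * G z)"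
proof (induction rule: hpoly.induct)
  case (hpoly_zeta M G i)
  from hpoly.hpoly_zeta[OF hpoly_zeta.IH, of i] show ?case by (simp add: mult.left_commute)
qed (auto simp: distrib_left intro: hpoly.intros)

lemma hpoly_sum: "(\<And>x. x \<in> S \<Longrightarrow> hpoly M (G x)) \<Longrightarrow> hpoly M (\<lambda>z. \<Sum>x\<in>S. G x z)"
  by (induction S rule: infinite_finite_induct) (auto intro: hpoly_zero hpoly_add)

lemma hpoly_mult: "hpoly M G \<Longrightarrow> hpoly N H \<Longrightarrow> hpoly (M + N) (\<lambda>z. G z * H z)"
  by (induction rule: hpoly.induct)
     (auto simp: distrib_right mult.assoc intro: hpoly_cmult hpoly.intros)

lemma hpoly_zeta_self: "hpoly (Suc 0) (zeta i)"
  using hpoly_zeta[OF hpoly_const[of 1], of i] by simp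

lemma hpoly_power: "hpoly M G \<Longrightarrow> hpoly (M * k) (\<lambda>z. G z ^ k)"
  by (induction k) (auto intro: hpoly_const hpoly_mult)

lemma hpoly_prod:
  "(\<And>x. x \<in> S \<Longrightarrow> hpoly (M x) (G x)) \<Longrightarrow> finite S \<Longrightarrow> hpoly (\<Sum>x\<in>S. M x) (\<lambda>z. \<Prod>x\<in>S. G x z)"
  by (induction S rule: infinite_finite_induct) (auto intro: hpoly_const hpoly_mult)

lemma hpoly_0_const: "hpoly 0 G \<Longrightarrow> \<exists>c. G = (\<lambda>z. c)"
  by (induction "0::nat" G rule: hpoly.induct) auto

lemma hpoly_differentiable_wirt:
  "hpoly M G \<Longrightarrow> (\<forall>z. G differentiable (at z)) \<and> (\<forall>i. hpoly (M - 1) (wirt i G))"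
proof (induction rule: hpoly.induct)
  case (hpoly_const c)
  have "wirt i (\<lambda>z. c) = (\<lambda>z. 0)" for i by (simp add: fun_eq_iff)
  then show ?case by (simp add: hpoly_zero)
next
  case (hpoly_zeta M G k)
  have dz: "zeta k differentiable (at z)" for z
    using bounded_linear_zeta bounded_linear_imp_differentiable by blast
  have "hpoly M (wirt i (\<lambda>z. zeta k z * G z))" for i
  proof -
    have eq: "wirt i (\<lambda>z. zeta k z * G z) = (\<lambda>z. of_bool (i = k) * G z + zeta k z * wirt i G z)"
      using hpoly_zeta.IH by (simp add: fun_eq_iff wirt_mult[OF dz] wirt_zeta)
    have "hpoly M (\<lambda>z. zeta k z * wirt i G z)"
    proof (cases M)
      case 0
      then show ?thesis using hpoly_0_const[of G] hpoly_zeta.hyps hpoly_zero by auto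
    next
      case (Suc M')
      then have "hpoly M' (wirt i G)" using hpoly_zeta.IH by simp
      from hpoly.hpoly_zeta[OF this] Suc show ?thesis by simp
    qed
    then show ?thesis
      unfolding eq by (intro hpoly_add hpoly_cmult hpoly_zeta.hyps)
  qed
  then show ?case using hpoly_zeta.IH dz by (auto intro: differentiable_mult)
next
  case (hpoly_add M G H)
  then have "wirt i (\<lambda>z. G z + H z) = (\<lambda>z. wirt i G z + wirt i H z)" for i
    by (simp add: fun_eq_iff wirt_add)
  then show ?case using hpoly_add by (auto intro: hpoly.hpoly_add)
qed

lemma hpoly_differentiable: "hpoly M G \<Longrightarrow> G differentiable (at z)"
  and hpoly_wirt: "hpoly M G \<Longrightarrow> hpoly (M - 1) (wirt i G)"
  using hpoly_differentiable_wirt by blast+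

lemma hpoly_wirt_Suc: "hpoly (Suc M) G \<Longrightarrow> hpoly M (wirt i G)"
  using hpoly_wirt by fastforce

lemma zeta_differentiable: "zeta k differentiable (at z)"
  using hpoly_differentiable[OF hpoly_zeta_self] .

lemma wirt_zeta_mult:
  "G differentiable (at z) \<Longrightarrow>
    wirt i (\<lambda>z. zeta k z * G z) z = of_bool (i = k) * G z + zeta k z * wirt i G z"
  by (simp add: wirt_mult[OF zeta_differentiable] wirt_zeta)

lemma hpoly_continuous_on: "hpoly M G \<Longrightarrow> continuous_on S G"
  by (meson continuous_at_imp_continuous_on differentiable_imp_continuous_within hpoly_differentiable)

lemma hpoly_bounded:
  assumes "hpoly M G"
  shows "\<exists>C. \<forall>z. norm z \<le> 1 \<longrightarrow> norm (G z) \<le> C"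
proof -
  have "bounded (G ` cball 0 1)"
    by (intro compact_imp_bounded compact_continuous_image hpoly_continuous_on[OF assms]) simp
  then show ?thesis
    unfolding bounded_iff by (metis dist_0_norm imageI mem_cball)
qed

lemma hpoly_homogeneous: "hpoly M G \<Longrightarrow> G (r *\<^sub>R z) = of_real r ^ M * G z"
  by (induction rule: hpoly.induct)
     (auto simp: linear_scale[OF linear_zeta] scaleR_conv_of_real[where 'a = complex] distrib_left)

lemma hpoly_Euler: "hpoly M G \<Longrightarrow> (\<Sum>k\<in>UNIV. zeta k z * wirt k G z) = of_nat M * G z"
proof (induction rule: hpoly.induct)
  case (hpoly_zeta M G i)
  have "(\<Sum>k\<in>UNIV. zeta k z * wirt k (\<lambda>z. zeta i z * G z) z)
      = (\<Sum>k\<in>UNIV. of_bool (k = i) * (zeta k z * G z)) + zeta i z * (\<Sum>k\<in>UNIV. zeta k z * wirt k G z)"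
    unfolding wirt_zeta_mult[OF hpoly_differentiable[OF hpoly_zeta.hyps]]
    by (simp add: sum.distrib sum_distrib_left algebra_simps)
  also have "(\<Sum>k\<in>UNIV. of_bool (k = i) * (zeta k z * G z)) = zeta i z * G z"
    by (subst sum.remove[of _ i]) auto
  finally show ?case by (simp add: hpoly_zeta.IH algebra_simps)
next
  case (hpoly_add M G H)
  then show ?case
    by (simp add: wirt_add hpoly_differentiable distrib_left sum.distrib)
qed simp

lemma wirt_commute: "hpoly M G \<Longrightarrow> wirt i (wirt k G) = wirt k (wirt i G)"
proof (induction rule: hpoly.induct)
  case (hpoly_const c)
  have "wirt j (\<lambda>z. c) = (\<lambda>z. 0)" for j by (simp add: fun_eq_iff)
  then show ?case by (simp add: fun_eq_iff)
next
  case (hpoly_zeta M G l)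
  note d = hpoly_differentiable[OF hpoly_zeta.hyps] hpoly_differentiable[OF hpoly_wirt[OF hpoly_zeta.hyps]]
  have eq: "wirt j (\<lambda>z. zeta l z * G z) = (\<lambda>z. of_bool (j = l) * G z + zeta l z * wirt j G z)" for j
    by (simp add: fun_eq_iff wirt_zeta_mult[OF d(1)])
  have "wirt i (wirt j (\<lambda>z. zeta l z * G z)) z
      = of_bool (j = l) * wirt i G z + of_bool (i = l) * wirt j G z + zeta l z * wirt i (wirt j G) z" for i j z
    unfolding eq using d
    by (simp add: wirt_add wirt_mult wirt_zeta zeta_differentiable)
  then show ?case using hpoly_zeta.IH by (simp add: fun_eq_iff)
next
  case (hpoly_add M G H)
  have eq: "wirt j (\<lambda>z. G z + H z) = (\<lambda>z. wirt j G z + wirt j H z)" for j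
    using hpoly_add.hyps by (simp add: fun_eq_iff wirt_add hpoly_differentiable)
  have "wirt i (wirt j (\<lambda>z. G z + H z)) z = wirt i (wirt j G) z + wirt i (wirt j H) z" for i j z
    unfolding eq using hpoly_add.hyps hpoly_wirt by (intro wirt_add) (blast intro: hpoly_differentiable)+
  then show ?case using hpoly_add.IH by (simp add: fun_eq_iff)
qed

section \<open>Spherical means of harmonic polynomials\<close>

definition unit_mean :: "('a::euclidean_space \<Rightarrow> complex) \<Rightarrow> complex" where
  "unit_mean G = (LINT w|sphere_measure 1. G w)"

lemma integrable_sphere_measure:
  fixes G :: "'a::euclidean_space \<Rightarrow> complex"
  assumes "G \<in> borel_measurable borel" "\<And>z. norm z \<le> 1 \<Longrightarrow> norm (G z) \<le> C"
  shows "integrable (sphere_measure 1) G"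
proof -
  interpret finite_measure "sphere_measure 1 :: 'a measure" by (rule finite_sphere_measure)
  show ?thesis
  proof (rule integrable_const_bound)
    show "AE z in sphere_measure 1. norm (G z) \<le> C"
      using AE_sphere_measure_norm[OF zero_le_one] by eventually_elim (auto intro: assms(2))
  qed (use assms(1) in simp)
qed

lemma integrable_hpoly: "hpoly M G \<Longrightarrow> integrable (sphere_measure 1) G"
  using hpoly_bounded[of M G]
  by (auto intro!: integrable_sphere_measure borel_measurable_continuous_onI hpoly_continuous_on)

lemma unit_mean_add: "hpoly M G \<Longrightarrow> hpoly N H \<Longrightarrow> unit_mean (\<lambda>z. G z + H z) = unit_mean G + unit_mean H"
  by (simp add: unit_mean_def integrable_hpoly)

lemma unit_mean_cmult: "unit_mean (\<lambda>z. c * G z) = c * unit_mean G"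
  by (simp add: unit_mean_def)

lemma unit_mean_sum: "(\<And>x. x \<in> S \<Longrightarrow> hpoly M (G x)) \<Longrightarrow> unit_mean (\<lambda>z. \<Sum>x\<in>S. G x z) = (\<Sum>x\<in>S. unit_mean (G x))"
  unfolding unit_mean_def by (rule Bochner_Integration.integral_sum) (rule integrable_hpoly)

lemma unit_mean_const [simp]: "unit_mean (\<lambda>z::'a::euclidean_space. c) = c"
  by (simp add: unit_mean_def measure_sphere_measure_UNIV)

lemma unit_mean_cong_sphere:
  assumes "\<And>z::'a::euclidean_space. norm z = 1 \<Longrightarrow> G z = H z"
    and "G \<in> borel_measurable borel" "H \<in> borel_measurable borel"
  shows "unit_mean G = unit_mean H"
  unfolding unit_mean_def
proof (rule integral_cong_AE)
  show "AE z in sphere_measure 1. G z = H z"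
    using AE_sphere_measure_norm[OF zero_le_one] by eventually_elim (auto intro: assms(1))
qed (use assms in simp_all)


text \<open>The rotation by the angle \<open>arcsin t\<close> in the plane of the orthonormal vectors \<open>u\<close> and \<open>v\<close>. With the sine
  as parameter, the deviation from the linear part \<open>z + t *\<^sub>R rotation_field u v z\<close> involves only
  \<open>sqrt (1 - t\<^sup>2) - 1\<close>.\<close>

definition plane_rotation :: "'a::real_inner \<Rightarrow> 'a \<Rightarrow> real \<Rightarrow> 'a \<Rightarrow> 'a" where
  "plane_rotation u v t z =
     z + ((sqrt (1 - t\<^sup>2) - 1) * (z \<bullet> u) - t * (z \<bullet> v)) *\<^sub>R u
       + ((sqrt (1 - t\<^sup>2) - 1) * (z \<bullet> v) + t * (z \<bullet> u)) *\<^sub>R v"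

definition rotation_field :: "'a::real_inner \<Rightarrow> 'a \<Rightarrow> 'a \<Rightarrow> 'a" where
  "rotation_field u v z = (z \<bullet> u) *\<^sub>R v - (z \<bullet> v) *\<^sub>R u"

lemma orthogonal_transformation_plane_rotation:
  fixes u v :: "'a::euclidean_space"
  assumes "norm u = 1" "norm v = 1" "u \<bullet> v = 0" "\<bar>t\<bar> \<le> 1"
  shows "orthogonal_transformation (plane_rotation u v t)"
  unfolding orthogonal_transformation
proof (intro conjI allI)
  show "linear (plane_rotation u v t)"
    by (rule linearI) (auto simp: plane_rotation_def algebra_simps)
  fix z
  define c where "c = sqrt (1 - t\<^sup>2)"
  have c: "c\<^sup>2 + t\<^sup>2 = 1"
    using assms(4) by (simp add: c_def abs_square_le_1)
  define a b where "a = z \<bullet> u" and "b = z \<bullet> v"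
  define p q where "p = (c - 1) * a - t * b" and "q = (c - 1) * b + t * a"
  have uv: "u \<bullet> u = 1" "v \<bullet> v = 1" "v \<bullet> u = 0"
    using assms by (simp_all add: norm_eq_1 inner_commute)
  have "plane_rotation u v t z = z + p *\<^sub>R u + q *\<^sub>R v"
    by (simp add: plane_rotation_def p_def q_def a_def b_def c_def)
  then have "(norm (plane_rotation u v t z))\<^sup>2 = z \<bullet> z + 2 * p * a + 2 * q * b + p\<^sup>2 + q\<^sup>2"
    unfolding power2_norm_eq_inner
    by (simp add: inner_add_left inner_add_right uv assms(3) a_def b_def
        inner_commute[of u z] inner_commute[of v z] power2_eq_square algebra_simps)
  also have "\<dots> = z \<bullet> z + (c\<^sup>2 + t\<^sup>2 - 1) * (a\<^sup>2 + b\<^sup>2)"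
    by (simp add: p_def q_def power2_eq_square algebra_simps)
  finally show "norm (plane_rotation u v t z) = norm z"
    by (simp add: c norm_eq_sqrt_inner)
qed

lemma plane_rotation_expansion:
  fixes u v :: "'a::euclidean_space"
  assumes "norm u = 1" "norm v = 1" "\<bar>t\<bar> \<le> 1" "norm z \<le> 1"
  shows "norm (plane_rotation u v t z - z - t *\<^sub>R rotation_field u v z) \<le> 2 * t\<^sup>2"
    and "norm (rotation_field u v z) \<le> 2"
proof -
  have t2: "t\<^sup>2 \<le> 1" using assms(3) by (simp add: abs_square_le_1)
  have "1 - t\<^sup>2 \<le> sqrt (1 - t\<^sup>2)"
    using t2 by (intro real_le_rsqrt) (simp add: power2_eq_square mult_left_le)
  moreover have "sqrt (1 - t\<^sup>2) \<le> 1" by simp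
  ultimately have c: "\<bar>sqrt (1 - t\<^sup>2) - 1\<bar> \<le> t\<^sup>2" by simp
  have a: "\<bar>z \<bullet> u\<bar> \<le> 1" "\<bar>z \<bullet> v\<bar> \<le> 1"
    using Cauchy_Schwarz_ineq2[of z u] Cauchy_Schwarz_ineq2[of z v] assms by auto
  have "plane_rotation u v t z - z - t *\<^sub>R rotation_field u v z
      = (sqrt (1 - t\<^sup>2) - 1) *\<^sub>R ((z \<bullet> u) *\<^sub>R u + (z \<bullet> v) *\<^sub>R v)"
    by (simp add: plane_rotation_def rotation_field_def algebra_simps)
  also have "norm \<dots> \<le> t\<^sup>2 * (1 + 1)"
    unfolding norm_scaleR
    by (intro mult_mono c order_trans[OF norm_triangle_ineq] add_mono) (use a assms in auto)
  finally show "norm (plane_rotation u v t z - z - t *\<^sub>R rotation_field u v z) \<le> 2 * t\<^sup>2" by simp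
  show "norm (rotation_field u v z) \<le> 2"
    using norm_triangle_ineq4[of "(z \<bullet> u) *\<^sub>R v" "(z \<bullet> v) *\<^sub>R u"] a assms
    by (simp add: rotation_field_def)
qed

text \<open>The derivative of \<open>G\<close> in the direction of the rotation field, written in complex coordinates.\<close>

definition along_rotation :: "complex^'n \<Rightarrow> complex^'n \<Rightarrow> (complex^'n::finite \<Rightarrow> complex) \<Rightarrow> complex^'n \<Rightarrow> complex" where
  "along_rotation u v G z = (\<Sum>k\<in>UNIV. zeta k (rotation_field u v z) * wirt k G z)"

text \<open>A first-order expansion that is uniform on the unit ball. It replaces differentiation under the
  integral sign, and for polynomials it is a product-rule induction on their construction.\<close>

lemma hpoly_rotation_expansion:
  fixes u v :: "complex^'n::finite"
  assumes uv: "norm u = 1" "norm v = 1" "u \<bullet> v = 0"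
  shows "hpoly M G \<Longrightarrow> \<exists>C. \<forall>z. norm z \<le> 1 \<longrightarrow> norm (along_rotation u v G z) \<le> C \<and>
    (\<forall>t. \<bar>t\<bar> \<le> 1 \<longrightarrow>
      norm (G (plane_rotation u v t z) - G z - of_real t * along_rotation u v G z) \<le> C * t\<^sup>2)"
proof (induction rule: hpoly.induct)
  case (hpoly_const c)
  show ?case by (intro exI[of _ 0]) (simp add: along_rotation_def)
next
  case (hpoly_zeta M G i)
  from hpoly_zeta.IH obtain C where C: "\<And>z. norm z \<le> 1 \<Longrightarrow> norm (along_rotation u v G z) \<le> C"
      "\<And>z t. norm z \<le> 1 \<Longrightarrow> \<bar>t\<bar> \<le> 1 \<Longrightarrow>
        norm (G (plane_rotation u v t z) - G z - of_real t * along_rotation u v G z) \<le> C * t\<^sup>2"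
    by blast
  from hpoly_bounded[OF hpoly_zeta.hyps] obtain B where B: "\<And>z. norm z \<le> 1 \<Longrightarrow> norm (G z) \<le> B" by blast
  have BC: "B \<ge> 0" "C \<ge> 0" using order_trans[OF norm_ge_zero B[of 0]] order_trans[OF norm_ge_zero C(1)[of 0]] by simp_all
  have V: "along_rotation u v (\<lambda>z. zeta i z * G z) z
      = zeta i (rotation_field u v z) * G z + zeta i z * along_rotation u v G z" for z
  proof -
    have "along_rotation u v (\<lambda>z. zeta i z * G z) z
      = (\<Sum>k\<in>UNIV. of_bool (k = i) * (zeta k (rotation_field u v z) * G z)) + zeta i z * along_rotation u v G z"
      unfolding along_rotation_def wirt_zeta_mult[OF hpoly_differentiable[OF hpoly_zeta.hyps]]
      by (simp add: sum.distrib sum_distrib_left algebra_simps)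
    also have "(\<Sum>k\<in>UNIV. of_bool (k = i) * (zeta k (rotation_field u v z) * G z))
        = zeta i (rotation_field u v z) * G z"
      by (subst sum.remove[of _ i]) auto
    finally show ?thesis .
  qed
  show ?case
  proof (intro exI[of _ "2 * B + 5 * C"] allI impI conjI)
    fix z :: "complex^'n" assume z: "norm z \<le> 1"
    let ?S = "zeta i (rotation_field u v z)" and ?V = "along_rotation u v G z"
    have S: "norm ?S \<le> 2"
      by (rule order_trans[OF zeta_norm_le plane_rotation_expansion(2)[OF uv(1,2), of 0 z]]) (simp_all add: z)
    have Z: "norm (zeta i z) \<le> 1" by (rule order_trans[OF zeta_norm_le z])
    have "norm (along_rotation u v (\<lambda>z. zeta i z * G z) z) \<le> 2 * B + 1 * C"
      unfolding V
      by (intro norm_triangle_mono; unfold norm_mult; intro mult_mono S B C Z z) auto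
    then show "norm (along_rotation u v (\<lambda>z. zeta i z * G z) z) \<le> 2 * B + 5 * C"
      using BC by simp
    fix t :: real assume t: "\<bar>t\<bar> \<le> 1"
    let ?R = "plane_rotation u v t z"
    have nR: "norm ?R \<le> 1"
      using orthogonal_transformation_plane_rotation[OF uv t] z by (simp add: orthogonal_transformation)
    have "zeta i ?R - zeta i z - of_real t * ?S = zeta i (?R - z - t *\<^sub>R rotation_field u v z)"
      by (simp add: linear_diff[OF linear_zeta] linear_scale[OF linear_zeta] scaleR_conv_of_real[where 'a = complex])
    then have A: "norm (zeta i ?R - zeta i z - of_real t * ?S) \<le> 2 * t\<^sup>2"
      using order_trans[OF zeta_norm_le plane_rotation_expansion(1)[OF uv(1,2) t z]] by simp
    have "zeta i ?R * G ?R - zeta i z * G z - of_real t * (?S * G z + zeta i z * ?V)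
        = (zeta i ?R - zeta i z - of_real t * ?S) * G ?R
          + (zeta i z + of_real t * ?S) * (G ?R - G z - of_real t * ?V) + of_real (t\<^sup>2) * (?S * ?V)"
      by (simp add: power2_eq_square algebra_simps)
    also have "norm \<dots> \<le> (2 * t\<^sup>2) * B + (1 + 1 * 2) * (C * t\<^sup>2) + t\<^sup>2 * (2 * C)"
    proof (intro norm_triangle_mono)
      show "norm ((zeta i ?R - zeta i z - of_real t * ?S) * G ?R) \<le> (2 * t\<^sup>2) * B"
        unfolding norm_mult by (intro mult_mono A B nR) auto
      have tS: "norm (of_real t * ?S) \<le> 1 * 2"
        unfolding norm_mult using t by (intro mult_mono S) auto
      show "norm ((zeta i z + of_real t * ?S) * (G ?R - G z - of_real t * ?V)) \<le> (1 + 1 * 2) * (C * t\<^sup>2)"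
        unfolding norm_mult by (intro mult_mono norm_triangle_mono Z tS C(2) z t) auto
      have "norm (?S * ?V) \<le> 2 * C"
        unfolding norm_mult by (intro mult_mono S C z) auto
      then show "norm (of_real (t\<^sup>2) * (?S * ?V)) \<le> t\<^sup>2 * (2 * C)"
        unfolding norm_mult[of "of_real (t\<^sup>2)"] by (intro mult_mono) (auto simp: norm_power)
    qed
    finally show "norm (zeta i ?R * G ?R - zeta i z * G z
        - of_real t * along_rotation u v (\<lambda>z. zeta i z * G z) z) \<le> (2 * B + 5 * C) * t\<^sup>2"
      unfolding V by (simp add: algebra_simps)
  qed
next
  case (hpoly_add M G H)
  from hpoly_add.IH(1) obtain C where C: "\<And>z. norm z \<le> 1 \<Longrightarrow> norm (along_rotation u v G z) \<le> C"
      "\<And>z t. norm z \<le> 1 \<Longrightarrow> \<bar>t\<bar> \<le> 1 \<Longrightarrow>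
        norm (G (plane_rotation u v t z) - G z - of_real t * along_rotation u v G z) \<le> C * t\<^sup>2"
    by blast
  from hpoly_add.IH(2) obtain D where D: "\<And>z. norm z \<le> 1 \<Longrightarrow> norm (along_rotation u v H z) \<le> D"
      "\<And>z t. norm z \<le> 1 \<Longrightarrow> \<bar>t\<bar> \<le> 1 \<Longrightarrow>
        norm (H (plane_rotation u v t z) - H z - of_real t * along_rotation u v H z) \<le> D * t\<^sup>2"
    by blast
  have V: "along_rotation u v (\<lambda>z. G z + H z) z = along_rotation u v G z + along_rotation u v H z" for z
    using hpoly_add.hyps
    by (simp add: along_rotation_def wirt_add hpoly_differentiable distrib_left sum.distrib)
  show ?case
  proof (intro exI[of _ "C + D"] allI impI conjI)
    fix z :: "complex^'n" assume z: "norm z \<le> 1"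
    show "norm (along_rotation u v (\<lambda>z. G z + H z) z) \<le> C + D"
      unfolding V by (intro norm_triangle_mono C D z)
    fix t :: real assume t: "\<bar>t\<bar> \<le> 1"
    show "norm (G (plane_rotation u v t z) + H (plane_rotation u v t z) - (G z + H z)
      - of_real t * along_rotation u v (\<lambda>z. G z + H z) z) \<le> (C + D) * t\<^sup>2"
      using norm_triangle_mono[OF C(2)[OF z t] D(2)[OF z t]] by (simp add: V algebra_simps)
  qed
qed

lemma integrable_along_rotation:
  assumes uv: "norm u = 1" "norm v = 1" "u \<bullet> v = 0" and G: "hpoly M G"
  shows "integrable (sphere_measure 1) (along_rotation u v G)"
proof -
  have "continuous_on UNIV (along_rotation u v G)"
    unfolding along_rotation_def rotation_field_def linear_diff[OF linear_zeta] linear_scale[OF linear_zeta]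
    by (intro continuous_intros hpoly_continuous_on[OF hpoly_wirt[OF G]])
  then show ?thesis
    using hpoly_rotation_expansion[OF uv G]
    by (auto intro!: integrable_sphere_measure borel_measurable_continuous_onI)
qed

text \<open>The means of \<open>G\<close> and of its rotated copies agree, so integrating the expansion leaves
  \<open>\<bar>t\<bar> * norm (unit_mean (along_rotation u v G)) \<le> C * t\<^sup>2\<close> for all small \<open>t\<close>.\<close>

lemma unit_mean_along_rotation:
  fixes u v :: "complex^'n::finite"
  assumes uv: "norm u = 1" "norm v = 1" "u \<bullet> v = 0" and G: "hpoly M G"
  shows "unit_mean (along_rotation u v G) = 0"
proof -
  obtain C where C: "\<And>z t. norm z \<le> 1 \<Longrightarrow> \<bar>t\<bar> \<le> 1 \<Longrightarrow>
        norm (G (plane_rotation u v t z) - G z - of_real t * along_rotation u v G z) \<le> C * t\<^sup>2"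
    using hpoly_rotation_expansion[OF uv G] by blast
  let ?M = "sphere_measure 1 :: (complex^'n) measure"
  let ?V = "along_rotation u v G"
  interpret finite_measure ?M by (rule finite_sphere_measure)
  have bd: "t * norm (unit_mean ?V) \<le> C * t\<^sup>2" if t: "0 < t" "t \<le> 1" for t :: real
  proof -
    let ?R = "plane_rotation u v t"
    have R: "orthogonal_transformation ?R"
      using t by (intro orthogonal_transformation_plane_rotation uv) simp
    have [measurable]: "?R \<in> borel_measurable borel"
      using R by (intro borel_measurable_continuous_onI)
        (simp add: orthogonal_transformation linear_continuous_on linear_linear)
    have mG[measurable]: "G \<in> borel_measurable borel"
      by (intro borel_measurable_continuous_onI hpoly_continuous_on[OF G])
    have iG: "integrable ?M G" by (rule integrable_hpoly[OF G])
    have eq: "(LINT z|?M. G (?R z)) = unit_mean G"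
      using integral_distr[of ?R ?M borel G] sphere_measure_orthogonal_transformation[OF R]
      by (simp add: unit_mean_def)
    have iGR: "integrable ?M (\<lambda>z. G (?R z))"
      using integrable_distr_eq[of ?R ?M borel G] sphere_measure_orthogonal_transformation[OF R] iG
      by simp
    have iV: "integrable ?M ?V" by (rule integrable_along_rotation[OF uv G])
    have "(LINT z|?M. G (?R z) - G z - of_real t * ?V z) = - (of_real t * unit_mean ?V)"
      using iG iGR iV by (simp add: eq) (simp add: unit_mean_def)
    moreover have "norm (LINT z|?M. G (?R z) - G z - of_real t * ?V z) \<le> (LINT z|?M. C * t\<^sup>2)"
    proof (rule order_trans[OF integral_norm_bound integral_mono_AE])
      show "integrable ?M (\<lambda>z. norm (G (?R z) - G z - of_real t * ?V z))" using iG iGR iV by simp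
    qed (use AE_sphere_measure_norm[OF zero_le_one] C t in \<open>auto elim!: eventually_mono\<close>)
    ultimately show ?thesis using t by (simp add: norm_mult measure_sphere_measure_UNIV)
  qed
  have "norm (unit_mean ?V) \<le> 0"
  proof (rule field_le_epsilon)
    fix e :: real assume e: "e > 0"
    \<comment> \<open>Small enough that the quadratic error, divided by \<open>t\<close>, is at most \<open>e\<close>.\<close>
    define t where "t = min 1 (e / (\<bar>C\<bar> + 1))"
    have t: "0 < t" "t \<le> 1" "t \<le> e / (\<bar>C\<bar> + 1)" using e by (auto simp: t_def)
    have "norm (unit_mean ?V) \<le> C * t" using bd[OF t(1,2)] t(1) by (simp add: power2_eq_square)
    also have "\<dots> \<le> (\<bar>C\<bar> + 1) * t" using t(1) by (intro mult_right_mono) auto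
    also have "\<dots> \<le> e" using t(3) by (simp add: field_simps)
    finally show "norm (unit_mean ?V) \<le> 0 + e" by simp
  qed
  then show ?thesis by simp
qed

lemma zeta_expand: "zeta i z = (\<Sum>u\<in>Basis. of_real (z \<bullet> u) * zeta i u)"
proof -
  have "zeta i z = zeta i (\<Sum>u\<in>Basis. (z \<bullet> u) *\<^sub>R u)" by (simp add: euclidean_representation)
  then show ?thesis
    by (simp only: linear_sum[OF linear_zeta] linear_scale[OF linear_zeta] scaleR_conv_of_real[where 'a = complex])
qed

text \<open>The passage from real to complex coordinates is unitary up to the factor \<open>2\<close>.\<close>

lemma zeta_orthogonality: "(\<Sum>v\<in>Basis. zeta (conj_index b) v * zeta k v) = 2 * of_bool (b = k)"
proof -
  have "(\<Sum>v\<in>Basis. zeta (conj_index b) v * zeta k v)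
      = (\<Sum>j\<in>UNIV. (if b = k then 2 * of_bool (b = Inl j \<or> b = Inr j) else 0))"
    unfolding sum_Basis_complex_vec
    by (rule sum.cong) (auto simp: zeta_def conj_index_def axis_def split: sum.splits)
  also have "\<dots> = 2 * of_bool (b = k)"
    by (cases b) (auto simp: of_bool_def sum_distrib_left[symmetric])
  finally show ?thesis .
qed

text \<open>The first-order operator \<open>zeta (conj_index a) * wirt b - zeta (conj_index b) * wirt a\<close> annihilates
  \<open>\<bar>z\<bar>\<^sup>2\<close>, and it is a complex linear combination of real rotation fields; hence it integrates to zero
  over the sphere.\<close>

lemma unit_mean_rotation_pair:
  fixes G :: "complex^'n::finite \<Rightarrow> complex"
  assumes G: "hpoly M G"
  shows "unit_mean (\<lambda>z. zeta (conj_index a) z * wirt b G z) = unit_mean (\<lambda>z. zeta (conj_index b) z * wirt a G z)"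
proof -
  let ?e = "\<lambda>u v. zeta (conj_index a) u * zeta (conj_index b) v :: complex"
  have X: "along_rotation u v G z
      = (\<Sum>k\<in>UNIV. (of_real (z \<bullet> u) * zeta k v - of_real (z \<bullet> v) * zeta k u) * wirt k G z)" for u v z
    by (simp add: along_rotation_def rotation_field_def linear_diff[OF linear_zeta]
        linear_scale[OF linear_zeta] scaleR_conv_of_real[where 'a = complex])
  have uv: "integrable (sphere_measure 1) (along_rotation u v G)" "unit_mean (along_rotation u v G) = 0"
    if "u \<in> Basis" "v \<in> Basis" for u v
  proof -
    have "integrable (sphere_measure 1) (along_rotation u v G) \<and> unit_mean (along_rotation u v G) = 0"
    proof (cases "u = v")
      case True
      then have "along_rotation u v G = (\<lambda>z. 0)" by (simp add: X fun_eq_iff)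
      then show ?thesis by simp
    next
      case False
      then show ?thesis
        using unit_mean_along_rotation[OF _ _ _ G] integrable_along_rotation[OF _ _ _ G] that
        by (auto simp: inner_not_same_Basis)
    qed
    then show "integrable (sphere_measure 1) (along_rotation u v G)" "unit_mean (along_rotation u v G) = 0"
      by auto
  qed
  have c: "(\<Sum>u\<in>Basis. \<Sum>v\<in>Basis. ?e u v * (of_real (z \<bullet> u) * zeta k v - of_real (z \<bullet> v) * zeta k u))
      = 2 * (of_bool (b = k) * zeta (conj_index a) z - of_bool (a = k) * zeta (conj_index b) z)" for z k
  proof -
    have "(\<Sum>u\<in>Basis. \<Sum>v\<in>Basis. ?e u v * (of_real (z \<bullet> u) * zeta k v - of_real (z \<bullet> v) * zeta k u))
      = (\<Sum>u\<in>Basis. of_real (z \<bullet> u) * zeta (conj_index a) u) * (\<Sum>v\<in>Basis. zeta (conj_index b) v * zeta k v)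
      - (\<Sum>u\<in>Basis. zeta (conj_index a) u * zeta k u) * (\<Sum>v\<in>Basis. of_real (z \<bullet> v) * zeta (conj_index b) v)"
      unfolding sum_product sum_subtractf[symmetric] by (simp add: algebra_simps)
    also have "\<dots> = zeta (conj_index a) z * (2 * of_bool (b = k)) - 2 * of_bool (a = k) * zeta (conj_index b) z"
      by (simp only: zeta_orthogonality zeta_expand[symmetric])
    finally show ?thesis by (simp add: algebra_simps)
  qed
  have "(\<Sum>u\<in>Basis. \<Sum>v\<in>Basis. ?e u v * along_rotation u v G z)
      = 2 * (zeta (conj_index a) z * wirt b G z) - 2 * (zeta (conj_index b) z * wirt a G z)" for z
  proof -
    have "(\<Sum>u\<in>Basis. \<Sum>v\<in>Basis. ?e u v * along_rotation u v G z)
      = (\<Sum>u\<in>Basis. \<Sum>v\<in>Basis. \<Sum>k\<in>UNIV.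
          ?e u v * (of_real (z \<bullet> u) * zeta k v - of_real (z \<bullet> v) * zeta k u) * wirt k G z)"
      by (simp only: X sum_distrib_left mult.assoc)
    also have "\<dots> = (\<Sum>u\<in>Basis. \<Sum>k\<in>UNIV. \<Sum>v\<in>Basis.
          ?e u v * (of_real (z \<bullet> u) * zeta k v - of_real (z \<bullet> v) * zeta k u) * wirt k G z)"
      by (intro sum.cong refl sum.swap)
    also have "\<dots> = (\<Sum>k\<in>UNIV. \<Sum>u\<in>Basis. \<Sum>v\<in>Basis.
          ?e u v * (of_real (z \<bullet> u) * zeta k v - of_real (z \<bullet> v) * zeta k u) * wirt k G z)"
      by (rule sum.swap)
    also have "\<dots> = (\<Sum>k\<in>UNIV. 2 * (of_bool (b = k) * zeta (conj_index a) z - of_bool (a = k) * zeta (conj_index b) z) * wirt k G z)"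
      by (simp only: sum_distrib_right[symmetric] c)
    also have "\<dots> = 2 * (\<Sum>k\<in>UNIV. of_bool (b = k) * (zeta (conj_index a) z * wirt k G z))
        - 2 * (\<Sum>k\<in>UNIV. of_bool (a = k) * (zeta (conj_index b) z * wirt k G z))"
      unfolding sum_distrib_left sum_subtractf[symmetric]
      by (rule sum.cong) (simp_all add: algebra_simps)
    also have "(\<Sum>k\<in>UNIV. of_bool (b = k) * (zeta (conj_index a) z * wirt k G z)) = zeta (conj_index a) z * wirt b G z"
      by (subst sum.remove[of _ b]) auto
    also have "(\<Sum>k\<in>UNIV. of_bool (a = k) * (zeta (conj_index b) z * wirt k G z)) = zeta (conj_index b) z * wirt a G z"
      by (subst sum.remove[of _ a]) auto
    finally show ?thesis .
  qed
  moreover have "unit_mean (\<lambda>z. \<Sum>u\<in>Basis. \<Sum>v\<in>Basis. ?e u v * along_rotation u v G z) = 0"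
    using uv by (simp add: unit_mean_def)
  ultimately have "unit_mean (\<lambda>z. 2 * (zeta (conj_index a) z * wirt b G z) - 2 * (zeta (conj_index b) z * wirt a G z)) = 0"
    by simp
  moreover have "integrable (sphere_measure 1) (\<lambda>z. zeta (conj_index c) z * wirt d G z)" for c d
    by (rule integrable_hpoly[OF hpoly_zeta[OF hpoly_wirt[OF G]]])
  ultimately show ?thesis by (simp add: unit_mean_def)
qed

text \<open>Integration by parts on the unit sphere. The previous lemma for the pair \<open>i\<close>, \<open>a\<close> is applied to
  \<open>zeta a * R\<close> and summed over \<open>a\<close>: one side is evaluated by Euler's identity, and on the other side
  the sum of \<open>zeta a * zeta (conj_index a)\<close> is \<open>2\<close> on the sphere.\<close>

lemma unit_mean_wirt:
  fixes R :: "complex^'n::finite \<Rightarrow> complex"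
  assumes R: "hpoly N R"
  shows "2 * unit_mean (wirt i R) = (of_nat (2 * CARD('n) + N) - 1) * unit_mean (\<lambda>z. zeta (conj_index i) z * R z)"
proof -
  let ?A = "unit_mean (\<lambda>z. zeta (conj_index i) z * R z)"
  note dR = hpoly_differentiable[OF R]
  have hz: "hpoly (Suc N) (\<lambda>z. zeta a z * R z)" for a by (rule hpoly_zeta[OF R])
  have h1: "hpoly (Suc N) (\<lambda>z. zeta a z * wirt b (\<lambda>z. zeta c z * R z) z)" for a b c
    by (intro hpoly_zeta hpoly_wirt_Suc hz)
  have "unit_mean (\<lambda>z. \<Sum>a\<in>UNIV. zeta (conj_index i) z * wirt a (\<lambda>z. zeta a z * R z) z)
      = unit_mean (\<lambda>z. \<Sum>a\<in>UNIV. zeta (conj_index a) z * wirt i (\<lambda>z. zeta a z * R z) z)"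
    by (subst (1 2) unit_mean_sum[OF h1]) (intro sum.cong refl unit_mean_rotation_pair[OF hz])
  also have "(\<lambda>z. \<Sum>a\<in>UNIV. zeta (conj_index i) z * wirt a (\<lambda>z. zeta a z * R z) z)
      = (\<lambda>z. of_nat (2 * CARD('n) + N) * (zeta (conj_index i) z * R z))"
    unfolding wirt_zeta_mult[OF dR] sum_distrib_left[symmetric] sum.distrib hpoly_Euler[OF R]
    by (simp add: card_UNIV_sum fun_eq_iff algebra_simps)
  also have "unit_mean \<dots> = of_nat (2 * CARD('n) + N) * ?A" by (rule unit_mean_cmult)
  also have "unit_mean (\<lambda>z. \<Sum>a\<in>UNIV. zeta (conj_index a) z * wirt i (\<lambda>z. zeta a z * R z) z)
      = unit_mean (\<lambda>z. zeta (conj_index i) z * R z + 2 * wirt i R z)"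
  proof (rule unit_mean_cong_sphere)
    fix z :: "complex^'n" assume z: "norm z = 1"
    have "(\<Sum>a\<in>UNIV. zeta (conj_index a) z * wirt i (\<lambda>z. zeta a z * R z) z)
        = (\<Sum>a\<in>UNIV. of_bool (i = a) * (zeta (conj_index a) z * R z))
          + (\<Sum>a\<in>UNIV. zeta a z * zeta (conj_index a) z) * wirt i R z"
      unfolding wirt_zeta_mult[OF dR] by (simp add: sum.distrib sum_distrib_right sum_distrib_left algebra_simps)
    also have "(\<Sum>a\<in>UNIV. of_bool (i = a) * (zeta (conj_index a) z * R z)) = zeta (conj_index i) z * R z"
      by (subst sum.remove[of _ i]) auto
    finally show "(\<Sum>a\<in>UNIV. zeta (conj_index a) z * wirt i (\<lambda>z. zeta a z * R z) z)
        = zeta (conj_index i) z * R z + 2 * wirt i R z"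
      by (simp add: sum_zeta_conj_index z)
  qed (intro borel_measurable_continuous_onI continuous_intros hpoly_continuous_on[OF h1]
        hpoly_continuous_on[OF hz] hpoly_continuous_on[OF hpoly_wirt[OF R]])+
  also have "\<dots> = ?A + 2 * unit_mean (wirt i R)"
    by (subst unit_mean_add[OF hz hpoly_cmult[OF hpoly_wirt[OF R]]]) (simp add: unit_mean_cmult)
  finally show ?thesis by (simp add: algebra_simps)
qed


text \<open>Up to a constant factor the sum is the Laplacian, in complex coordinates.\<close>

definition harmonic_hpoly :: "nat \<Rightarrow> (complex^'n::finite \<Rightarrow> complex) \<Rightarrow> bool" where
  "harmonic_hpoly N H \<longleftrightarrow> hpoly N H \<and> (\<forall>z. (\<Sum>i\<in>UNIV. wirt (conj_index i) (wirt i H) z) = 0)"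

lemma wirt_sum:
  assumes "\<And>x. x \<in> S \<Longrightarrow> hpoly N (G x)" "finite S"
  shows "wirt i (\<lambda>z. \<Sum>x\<in>S. G x z) z = (\<Sum>x\<in>S. wirt i (G x) z)"
  using assms(2,1)
proof (induction S)
  case (insert x S)
  have "wirt i (\<lambda>z. G x z + (\<Sum>x\<in>S. G x z)) z = wirt i (G x) z + wirt i (\<lambda>z. \<Sum>x\<in>S. G x z) z"
    using insert.prems by (intro wirt_add hpoly_differentiable[OF hpoly_sum] hpoly_differentiable) auto
  then show ?case using insert by simp
qed simp

lemma harmonic_hpoly_wirt:
  assumes "harmonic_hpoly (Suc N) H"
  shows "harmonic_hpoly N (wirt i H)"
proof -
  have H: "hpoly (Suc N) H" and lap: "\<And>z. (\<Sum>k\<in>UNIV. wirt (conj_index k) (wirt k H) z) = 0"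
    using assms by (auto simp: harmonic_hpoly_def)
  have h: "hpoly (N - 1) (wirt (conj_index k) (wirt k H))" for k
    by (intro hpoly_wirt hpoly_wirt_Suc H)
  have "(\<Sum>k\<in>UNIV. wirt (conj_index k) (wirt k (wirt i H)) z) = 0" for z
  proof -
    have "wirt (conj_index k) (wirt k (wirt i H)) = wirt i (wirt (conj_index k) (wirt k H))" for k
      by (metis H hpoly_wirt wirt_commute)
    then have "(\<Sum>k\<in>UNIV. wirt (conj_index k) (wirt k (wirt i H)) z)
        = wirt i (\<lambda>z. \<Sum>k\<in>UNIV. wirt (conj_index k) (wirt k H) z) z"
      by (simp add: wirt_sum[OF h])
    then show ?thesis by (simp add: lap)
  qed
  then show ?thesis using hpoly_wirt_Suc[OF H] by (simp add: harmonic_hpoly_def)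
qed

lemma CARD_factor_nonzero: "(of_nat (2 * CARD('n::finite) + N) - 1 :: complex) \<noteq> 0"
proof -
  have "CARD('n) \<ge> 1" by (simp add: Suc_leI)
  then have "of_nat (2 * CARD('n) + N) \<noteq> (of_nat 1 :: complex)"
    by (subst of_nat_eq_iff) linarith
  then show ?thesis by simp
qed

text \<open>By Euler's identity \<open>H\<close> is a multiple of the sum of \<open>zeta k * wirt k H\<close>, and integrating each term by
  parts turns this sum into the Laplacian.\<close>

lemma unit_mean_harmonic:
  fixes H :: "complex^'n::finite \<Rightarrow> complex"
  assumes "harmonic_hpoly (Suc N) H"
  shows "unit_mean H = 0"
proof -
  have H: "hpoly (Suc N) H" and lap: "\<And>z. (\<Sum>k\<in>UNIV. wirt (conj_index k) (wirt k H) z) = 0"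
    using assms by (auto simp: harmonic_hpoly_def)
  let ?c = "of_nat (2 * CARD('n) + N) - 1 :: complex"
  have h1: "hpoly (Suc N) (\<lambda>z. zeta k z * wirt k H z)" for k
    by (intro hpoly_zeta hpoly_wirt_Suc H)
  have h2: "hpoly (N - 1) (wirt (conj_index k) (wirt k H))" for k
    by (intro hpoly_wirt hpoly_wirt_Suc H)
  have "?c * (of_nat (Suc N) * unit_mean H) = ?c * unit_mean (\<lambda>z. \<Sum>k\<in>UNIV. zeta k z * wirt k H z)"
    by (simp only: hpoly_Euler[OF H] unit_mean_cmult)
  also have "\<dots> = (\<Sum>k\<in>UNIV. ?c * unit_mean (\<lambda>z. zeta k z * wirt k H z))"
    by (simp only: unit_mean_sum[OF h1] sum_distrib_left)
  also have "\<dots> = (\<Sum>k\<in>UNIV. 2 * unit_mean (wirt (conj_index k) (wirt k H)))"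
    using unit_mean_wirt[OF hpoly_wirt_Suc[OF H], of "conj_index _"] by simp
  also have "\<dots> = 2 * unit_mean (\<lambda>z. \<Sum>k\<in>UNIV. wirt (conj_index k) (wirt k H) z)"
    by (simp only: unit_mean_sum[OF h2] sum_distrib_left)
  also have "\<dots> = 0" by (simp add: lap)
  finally show ?thesis using CARD_factor_nonzero[where 'n='n, of N] by (simp del: of_nat_add of_nat_Suc)
qed

lemma unit_mean_zeta_mult:
  fixes G H :: "complex^'n::finite \<Rightarrow> complex"
  assumes G: "hpoly M G" and H: "hpoly N H"
  shows "(of_nat (2 * CARD('n) + (M + N)) - 1) * unit_mean (\<lambda>z. zeta (conj_index i) z * G z * H z)
    = 2 * unit_mean (\<lambda>z. wirt i G z * H z) + 2 * unit_mean (\<lambda>z. G z * wirt i H z)"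
proof -
  have "wirt i (\<lambda>z. G z * H z) = (\<lambda>z. wirt i G z * H z + G z * wirt i H z)"
    by (simp add: fun_eq_iff wirt_mult hpoly_differentiable[OF G] hpoly_differentiable[OF H])
  then have "unit_mean (wirt i (\<lambda>z. G z * H z)) = unit_mean (\<lambda>z. wirt i G z * H z) + unit_mean (\<lambda>z. G z * wirt i H z)"
    using unit_mean_add[OF hpoly_mult[OF hpoly_wirt[OF G] H] hpoly_mult[OF G hpoly_wirt[OF H]]] by simp
  then show ?thesis
    using unit_mean_wirt[OF hpoly_mult[OF G H], of i] by (simp add: mult.assoc algebra_simps)
qed

text \<open>Coordinate factors of \<open>G\<close> are integrated by parts one after the other. Each step either lowers the
  degree of \<open>G\<close> by two or that of both \<open>G\<close> and \<open>H\<close> by one, so the inequality of degrees persists until \<open>G\<close>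
  is constant and \<open>H\<close> is still harmonic of positive degree.\<close>

lemma unit_mean_orthogonal:
  fixes G H :: "complex^'n::finite \<Rightarrow> complex"
  assumes "hpoly M G" "harmonic_hpoly N H" "M < N"
  shows "unit_mean (\<lambda>z. G z * H z) = 0"
  using assms
proof (induction M arbitrary: N G H rule: less_induct)
  case (less M)
  from less.prems(1) less.IH less.prems(2,3) show ?case
  proof (induction rule: hpoly.induct)
    case (hpoly_const c)
    then show ?case using unit_mean_harmonic[of "N - 1" H] by (simp add: unit_mean_cmult)
  next
    case (hpoly_zeta M G i)
    obtain N' where N: "N = Suc N'" using hpoly_zeta.prems by (cases N) auto
    have H: "harmonic_hpoly (Suc N') H" "hpoly N H"
      using hpoly_zeta.prems N by (auto simp: harmonic_hpoly_def)
    have "unit_mean (\<lambda>z. wirt (conj_index i) G z * H z) = 0"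
      using hpoly_zeta.prems hpoly_wirt[OF hpoly_zeta.hyps(1)]
      by (intro hpoly_zeta.prems(1)[of "M - 1"]) auto
    moreover have "unit_mean (\<lambda>z. G z * wirt (conj_index i) H z) = 0"
      using hpoly_zeta.prems harmonic_hpoly_wirt[OF H(1)] hpoly_zeta.hyps N
      by (intro hpoly_zeta.prems(1)[of M]) auto
    ultimately show ?case
      using unit_mean_zeta_mult[OF hpoly_zeta.hyps H(2), of "conj_index i"] CARD_factor_nonzero[where 'n='n, of "M + N"]
      by simp
  next
    case (hpoly_add M G G')
    have H: "hpoly N H" using hpoly_add.prems by (simp add: harmonic_hpoly_def)
    have "unit_mean (\<lambda>z. G z * H z + G' z * H z) = unit_mean (\<lambda>z. G z * H z) + unit_mean (\<lambda>z. G' z * H z)"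
      by (rule unit_mean_add[OF hpoly_mult[OF hpoly_add.hyps(1) H] hpoly_mult[OF hpoly_add.hyps(2) H]])
    then show ?case using hpoly_add by (simp add: distrib_right)
  qed
qed

text \<open>In the top degree, multiplication by \<open>zeta (conj_index i)\<close> is adjoint to \<open>wirt i\<close> up to a positive factor:
  integration by parts produces one more term, with \<open>wirt i G\<close>, and its degree is too low to pair with \<open>H\<close>.\<close>

lemma unit_mean_zeta_pairing:
  fixes G H :: "complex^'n::finite \<Rightarrow> complex"
  assumes G: "hpoly N G" and H: "harmonic_hpoly (Suc N) H"
  shows "of_nat (CARD('n) + N) * unit_mean (\<lambda>z. zeta (conj_index i) z * G z * H z) = unit_mean (\<lambda>z. G z * wirt i H z)"
proof -
  have "unit_mean (\<lambda>z. wirt i G z * H z) = 0"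
    by (rule unit_mean_orthogonal[OF hpoly_wirt[OF G] H]) simp
  then have "2 * (of_nat (CARD('n) + N) * unit_mean (\<lambda>z. zeta (conj_index i) z * G z * H z))
      = 2 * unit_mean (\<lambda>z. G z * wirt i H z)"
    using unit_mean_zeta_mult[OF G, of "Suc N" H i] H by (simp add: harmonic_hpoly_def algebra_simps)
  then show ?thesis by (simp only: mult_cancel_left) simp
qed

section \<open>First-order operators on the half-line\<close>

text \<open>\<open>k\<close>-fold differentiability on the open half-line. The values for \<open>t \<le> 0\<close> are left free, since a
  radial profile as a function of \<open>t = \<bar>z\<bar>\<^sup>2\<close> is meaningful and smooth only for \<open>t > 0\<close>.\<close>

fun diff_times :: "nat \<Rightarrow> (real \<Rightarrow> complex) \<Rightarrow> bool" where
  "diff_times 0 \<phi> \<longleftrightarrow> True"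
| "diff_times (Suc k) \<phi> \<longleftrightarrow> (\<exists>\<phi>'. (\<forall>t>0. (\<phi> has_vector_derivative \<phi>' t) (at t)) \<and> diff_times k \<phi>')"

definition smooth_pos :: "(real \<Rightarrow> complex) \<Rightarrow> bool" where
  "smooth_pos \<phi> \<longleftrightarrow> (\<forall>k. diff_times k \<phi>)"

declare diff_times.simps(2) [simp del]

lemma has_vector_derivative_cong_pos:
  fixes \<phi> :: "real \<Rightarrow> complex"
  assumes "\<And>t. t > 0 \<Longrightarrow> \<phi> t = \<psi> t" "t > 0" "(\<phi> has_vector_derivative d) (at t)"
  shows "(\<psi> has_vector_derivative d) (at t)"
  using has_vector_derivative_transform_within_open[OF assms(3), of "{0<..}" \<psi>] assms(1,2) by auto

lemma diff_times_SucI: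
  "(\<And>t. t > 0 \<Longrightarrow> (\<phi> has_vector_derivative \<phi>' t) (at t)) \<Longrightarrow> diff_times k \<phi>' \<Longrightarrow> diff_times (Suc k) \<phi>"
  unfolding diff_times.simps by blast

lemma diff_times_SucE:
  assumes "diff_times (Suc k) \<phi>"
  obtains \<phi>' where "\<And>t. t > 0 \<Longrightarrow> (\<phi> has_vector_derivative \<phi>' t) (at t)" "diff_times k \<phi>'"
  using assms unfolding diff_times.simps by blast

lemma diff_times_cong:
  assumes "\<And>t. t > 0 \<Longrightarrow> \<phi> t = \<psi> t" "diff_times k \<phi>"
  shows "diff_times k \<psi>"
proof (cases k)
  case (Suc j)
  from assms(2)[unfolded Suc] obtain \<phi>' where
    "\<And>t. t > 0 \<Longrightarrow> (\<phi> has_vector_derivative \<phi>' t) (at t)" "diff_times j \<phi>'" by (rule diff_times_SucE) blast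
  moreover from this(1) have "(\<psi> has_vector_derivative \<phi>' t) (at t)" if "t > 0" for t
    using has_vector_derivative_cong_pos[of \<phi> \<psi>, OF assms(1)] that by blast
  ultimately show ?thesis unfolding Suc by (blast intro: diff_times_SucI)
qed simp

lemma diff_times_SucD: "diff_times (Suc k) \<phi> \<Longrightarrow> diff_times k \<phi>"
proof (induction k arbitrary: \<phi>)
  case (Suc k)
  from Suc.prems obtain \<phi>' where
    "\<And>t. t > 0 \<Longrightarrow> (\<phi> has_vector_derivative \<phi>' t) (at t)" "diff_times (Suc k) \<phi>'"
    by (rule diff_times_SucE) blast
  then show ?case by (intro diff_times_SucI[of \<phi> \<phi>'] Suc.IH)
qed simp

lemma diff_times_const: "diff_times k (\<lambda>t. c)"
proof (induction k arbitrary: c)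
  case (Suc k)
  show ?case by (rule diff_times_SucI[of _ "\<lambda>t. 0"]) (simp_all add: Suc)
qed simp

lemma diff_times_add: "diff_times k \<phi> \<Longrightarrow> diff_times k \<psi> \<Longrightarrow> diff_times k (\<lambda>t. \<phi> t + \<psi> t)"
proof (induction k arbitrary: \<phi> \<psi>)
  case (Suc k)
  from Suc.prems(1) obtain \<phi>' where 1:
    "\<And>t. t > 0 \<Longrightarrow> (\<phi> has_vector_derivative \<phi>' t) (at t)" "diff_times k \<phi>'" by (rule diff_times_SucE) blast
  from Suc.prems(2) obtain \<psi>' where 2:
    "\<And>t. t > 0 \<Longrightarrow> (\<psi> has_vector_derivative \<psi>' t) (at t)" "diff_times k \<psi>'" by (rule diff_times_SucE) blast
  show ?case
    by (rule diff_times_SucI[of _ "\<lambda>t. \<phi>' t + \<psi>' t"])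
       (intro has_vector_derivative_add 1 2 Suc.IH; assumption)+
qed simp

lemma diff_times_mult: "diff_times k \<phi> \<Longrightarrow> diff_times k \<psi> \<Longrightarrow> diff_times k (\<lambda>t. \<phi> t * \<psi> t)"
proof (induction k arbitrary: \<phi> \<psi>)
  case (Suc k)
  from Suc.prems(1) obtain \<phi>' where 1:
    "\<And>t. t > 0 \<Longrightarrow> (\<phi> has_vector_derivative \<phi>' t) (at t)" "diff_times k \<phi>'" by (rule diff_times_SucE) blast
  from Suc.prems(2) obtain \<psi>' where 2:
    "\<And>t. t > 0 \<Longrightarrow> (\<psi> has_vector_derivative \<psi>' t) (at t)" "diff_times k \<psi>'" by (rule diff_times_SucE) blast
  show ?case
  proof (rule diff_times_SucI[of _ "\<lambda>t. \<phi> t * \<psi>' t + \<phi>' t * \<psi> t"])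
    show "diff_times k (\<lambda>t. \<phi> t * \<psi>' t + \<phi>' t * \<psi> t)"
      by (intro diff_times_add Suc.IH 1 2 diff_times_SucD[OF Suc.prems(1)] diff_times_SucD[OF Suc.prems(2)])
  qed (rule has_vector_derivative_mult[OF 1(1) 2(1)])
qed simp

lemma diff_times_powr: "diff_times k (\<lambda>t. of_real (t powr c))"
proof (induction k arbitrary: c)
  case (Suc k)
  show ?case
  proof (rule diff_times_SucI[of _ "\<lambda>t. of_real c * of_real (t powr (c - 1))"])
    show "diff_times k (\<lambda>t. of_real c * of_real (t powr (c - 1)))"
      by (rule diff_times_mult[OF diff_times_const Suc.IH])
    fix t :: real assume "t > 0"
    from has_vector_derivative_of_real[OF has_real_derivative_powr[OF this, of c]]
    show "((\<lambda>t. of_real (t powr c)) has_vector_derivative of_real c * of_real (t powr (c - 1))) (at t)"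
      unfolding of_real_mult .
  qed
qed simp

lemma smooth_pos_const: "smooth_pos (\<lambda>t. c)"
  and smooth_pos_add: "smooth_pos \<phi> \<Longrightarrow> smooth_pos \<psi> \<Longrightarrow> smooth_pos (\<lambda>t. \<phi> t + \<psi> t)"
  and smooth_pos_mult: "smooth_pos \<phi> \<Longrightarrow> smooth_pos \<psi> \<Longrightarrow> smooth_pos (\<lambda>t. \<phi> t * \<psi> t)"
  and smooth_pos_powr: "smooth_pos (\<lambda>t. of_real (t powr r))"
  unfolding smooth_pos_def by (blast intro: diff_times_const diff_times_add diff_times_mult diff_times_powr)+

lemma smooth_pos_cong: "(\<And>t. t > 0 \<Longrightarrow> \<phi> t = \<psi> t) \<Longrightarrow> smooth_pos \<phi> \<Longrightarrow> smooth_pos \<psi>"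
  unfolding smooth_pos_def using diff_times_cong by blast

lemma smooth_pos_power: "smooth_pos (\<lambda>t. of_real t ^ k)"
  by (rule smooth_pos_cong[OF _ smooth_pos_powr[of "real k"]]) (simp add: powr_realpow)

definition vderiv :: "(real \<Rightarrow> complex) \<Rightarrow> real \<Rightarrow> complex" where
  "vderiv \<phi> t = vector_derivative \<phi> (at t)"

lemma has_vderiv:
  assumes "smooth_pos \<phi>" "t > 0"
  shows "(\<phi> has_vector_derivative vderiv \<phi> t) (at t)"
proof -
  have "diff_times (Suc 0) \<phi>" using assms(1) unfolding smooth_pos_def ..
  then obtain \<phi>' where "\<And>t. t > 0 \<Longrightarrow> (\<phi> has_vector_derivative \<phi>' t) (at t)" by (rule diff_times_SucE) blast
  from this[OF assms(2)] show ?thesis unfolding vderiv_def by (simp add: vector_derivative_at)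
qed

lemma vderiv_eq: "(\<phi> has_vector_derivative d) (at t) \<Longrightarrow> vderiv \<phi> t = d"
  unfolding vderiv_def by (rule vector_derivative_at)

lemma smooth_pos_vderiv:
  assumes "smooth_pos \<phi>"
  shows "smooth_pos (vderiv \<phi>)"
  unfolding smooth_pos_def
proof
  fix k
  have "diff_times (Suc k) \<phi>" using assms unfolding smooth_pos_def ..
  then obtain \<phi>' where "\<And>t. t > 0 \<Longrightarrow> (\<phi> has_vector_derivative \<phi>' t) (at t)" "diff_times k \<phi>'"
    by (rule diff_times_SucE) blast
  then show "diff_times k (vderiv \<phi>)" using diff_times_cong[of \<phi>' "vderiv \<phi>" k] vderiv_eq by metis
qed

text \<open>The operator \<open>d/dt + c\<close>. Lists of constants stand for compositions, with the last entry acting first.\<close>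

definition shifted_deriv :: "real \<Rightarrow> (real \<Rightarrow> complex) \<Rightarrow> real \<Rightarrow> complex" where
  "shifted_deriv c \<phi> t = vderiv \<phi> t + of_real c * \<phi> t"

lemma smooth_pos_shifted_deriv: "smooth_pos \<phi> \<Longrightarrow> smooth_pos (shifted_deriv c \<phi>)"
  unfolding shifted_deriv_def by (intro smooth_pos_add smooth_pos_mult smooth_pos_const smooth_pos_vderiv)

lemma smooth_pos_shifted_derivs: "smooth_pos \<phi> \<Longrightarrow> smooth_pos (foldr shifted_deriv cs \<phi>)"
  by (induction cs) (auto intro: smooth_pos_shifted_deriv)

lemma shifted_deriv_cong:
  assumes "smooth_pos \<phi>" "\<And>t. t > 0 \<Longrightarrow> \<phi> t = \<psi> t" "t > 0"
  shows "shifted_deriv c \<phi> t = shifted_deriv c \<psi> t"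
  using has_vector_derivative_cong_pos[OF assms(2,3) has_vderiv[OF assms(1,3)]] assms(2,3)
  by (simp add: shifted_deriv_def vderiv_eq)

lemma shifted_derivs_cong:
  assumes "smooth_pos \<phi>" "\<And>t. t > 0 \<Longrightarrow> \<phi> t = \<psi> t" "t > 0"
  shows "foldr shifted_deriv cs \<phi> t = foldr shifted_deriv cs \<psi> t"
  using assms(3)
proof (induction cs arbitrary: t)
  case (Cons c cs)
  then show ?case using shifted_deriv_cong[OF smooth_pos_shifted_derivs[OF assms(1)], of cs "foldr shifted_deriv cs \<psi>" t c] by simp
qed (simp add: assms(2))

lemma shifted_deriv_linear:
  assumes "smooth_pos \<phi>" "smooth_pos \<psi>" "t > 0"
  shows "shifted_deriv c (\<lambda>t. a * \<phi> t + b * \<psi> t) t = a * shifted_deriv c \<phi> t + b * shifted_deriv c \<psi> t"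
proof -
  have "((\<lambda>t. a * \<phi> t + b * \<psi> t) has_vector_derivative (a * vderiv \<phi> t + b * vderiv \<psi> t)) (at t)"
    by (intro has_vector_derivative_add has_vector_derivative_mult_right has_vderiv assms)
  then show ?thesis by (simp add: shifted_deriv_def vderiv_eq algebra_simps)
qed

lemma shifted_derivs_linear:
  assumes "smooth_pos \<phi>" "smooth_pos \<psi>" "t > 0"
  shows "foldr shifted_deriv cs (\<lambda>t. a * \<phi> t + b * \<psi> t) t = a * foldr shifted_deriv cs \<phi> t + b * foldr shifted_deriv cs \<psi> t"
  using assms(3)
proof (induction cs arbitrary: t)
  case (Cons c cs)
  let ?L = "\<lambda>t. a * foldr shifted_deriv cs \<phi> t + b * foldr shifted_deriv cs \<psi> t"
  have "smooth_pos ?L"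
    by (intro smooth_pos_add smooth_pos_mult smooth_pos_const smooth_pos_shifted_derivs assms)
  then have "shifted_deriv c (foldr shifted_deriv cs (\<lambda>t. a * \<phi> t + b * \<psi> t)) t = shifted_deriv c ?L t"
    using shifted_deriv_cong[of ?L "foldr shifted_deriv cs (\<lambda>t. a * \<phi> t + b * \<psi> t)" t c] Cons by simp
  also have "\<dots> = a * shifted_deriv c (foldr shifted_deriv cs \<phi>) t + b * shifted_deriv c (foldr shifted_deriv cs \<psi>) t"
    by (intro shifted_deriv_linear smooth_pos_shifted_derivs assms Cons.prems)
  finally show ?case by simp
qed simp

lemma has_vector_derivative_shift:
  fixes \<phi> :: "real \<Rightarrow> complex"
  assumes "(\<phi> has_vector_derivative d) (at (t + h))"
  shows "((\<lambda>t. \<phi> (t + h)) has_vector_derivative d) (at t)"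
proof -
  have "((\<lambda>t. t + h) has_vector_derivative 1) (at t)"
    by (auto intro!: derivative_eq_intros)
  from vector_diff_chain_at[OF this, of \<phi> d] assms show ?thesis by (simp add: o_def)
qed

lemma diff_times_shift: "h \<ge> 0 \<Longrightarrow> diff_times k \<phi> \<Longrightarrow> diff_times k (\<lambda>t. \<phi> (t + h))"
proof (induction k arbitrary: \<phi>)
  case (Suc k)
  from Suc.prems(2) obtain \<phi>' where d:
    "\<And>t. t > 0 \<Longrightarrow> (\<phi> has_vector_derivative \<phi>' t) (at t)" "diff_times k \<phi>'" by (rule diff_times_SucE) blast
  show ?case
    by (rule diff_times_SucI[of _ "\<lambda>t. \<phi>' (t + h)"])
       (use Suc d in \<open>auto intro!: has_vector_derivative_shift\<close>)
qed simp

lemma smooth_pos_shift: "h \<ge> 0 \<Longrightarrow> smooth_pos \<phi> \<Longrightarrow> smooth_pos (\<lambda>t. \<phi> (t + h))"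
  by (simp add: smooth_pos_def diff_times_shift)

lemma shifted_derivs_shift:
  assumes "smooth_pos \<phi>" "h \<ge> 0" "t > 0"
  shows "foldr shifted_deriv cs (\<lambda>t. \<phi> (t + h)) t = foldr shifted_deriv cs \<phi> (t + h)"
  using assms(3)
proof (induction cs arbitrary: t)
  case (Cons c cs)
  let ?L = "\<lambda>t. foldr shifted_deriv cs \<phi> (t + h)"
  have sm: "smooth_pos (foldr shifted_deriv cs \<phi>)" by (rule smooth_pos_shifted_derivs[OF assms(1)])
  have "shifted_deriv c (foldr shifted_deriv cs (\<lambda>t. \<phi> (t + h))) t = shifted_deriv c ?L t"
    using shifted_deriv_cong[of ?L "foldr shifted_deriv cs (\<lambda>t. \<phi> (t + h))" t c] Cons smooth_pos_shift[OF assms(2) sm] by simp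
  also have "\<dots> = shifted_deriv c (foldr shifted_deriv cs \<phi>) (t + h)"
    using has_vector_derivative_shift[OF has_vderiv[OF sm], of t h] Cons.prems assms(2)
    by (simp add: shifted_deriv_def vderiv_eq)
  finally show ?case by simp
qed simp

lemma shifted_deriv_zero_exponential:
  assumes y: "smooth_pos y" and z: "\<And>t. t > T \<Longrightarrow> shifted_deriv c y t = 0" and T: "T \<ge> 0" "t > T" "h \<ge> 0"
  shows "y (t + h) = of_real (exp (- c * h)) * y t"
proof -
  let ?g = "\<lambda>t. of_real (exp (c * t)) * y t"
  have d: "(?g has_vector_derivative 0) (at x within {T<..})" if "x \<in> {T<..}" for x
  proof -
    have "((\<lambda>t. complex_of_real (exp (c * t))) has_vector_derivative of_real (exp (c * x) * c)) (at x)"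
      by (rule has_vector_derivative_of_real) (auto intro!: derivative_eq_intros)
    from has_vector_derivative_mult[OF this has_vderiv[OF y]] that T
    have "(?g has_vector_derivative of_real (exp (c * x)) * vderiv y x + of_real (exp (c * x) * c) * y x) (at x)"
      by auto
    also have "of_real (exp (c * x)) * vderiv y x + of_real (exp (c * x) * c) * y x = of_real (exp (c * x)) * shifted_deriv c y x"
      by (simp add: shifted_deriv_def algebra_simps)
    finally show ?thesis using z[of x] that by (simp add: has_vector_derivative_at_within)
  qed
  obtain k where "\<And>x. x \<in> {T<..} \<Longrightarrow> ?g x = k"
    using has_vector_derivative_zero_constant[of "{T<..}" ?g] d by auto
  then have "?g (t + h) = ?g t" using T by simp
  then have "of_real (exp (- (c * (t + h)))) * ?g (t + h) = of_real (exp (- (c * (t + h)))) * ?g t" by simp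
  then show ?thesis
    by (simp add: mult.assoc[symmetric] flip: of_real_mult exp_add) (simp add: algebra_simps)
qed

text \<open>Induction over the factors, using differences instead of derivatives, since decay of \<open>w\<close> says nothing
  about decay of its derivatives. The outermost factor \<open>d/dt + c\<close> annihilates the image of \<open>w\<close> under the
  other factors, so that image is a multiple of \<open>exp (- c * t)\<close>. Therefore the other factors annihilate
  \<open>w (t + h) - exp (- c * h) * w t\<close>, which decays like \<open>w\<close> and vanishes by induction. Thus
  \<open>w (t + h) = exp (- c * h) * w t\<close> for all \<open>h\<close>, and as \<open>c \<le> M\<close> this contradicts the decay of \<open>w\<close> unless
  \<open>w t = 0\<close>.\<close>

lemma decaying_solution_zero:
  assumes "smooth_pos w" "T \<ge> 0" "\<And>t. t > T \<Longrightarrow> foldr shifted_deriv cs w t = 0"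
    and "\<And>c. c \<in> set cs \<Longrightarrow> c \<le> M"
    and "((\<lambda>t. of_real (exp (M * t)) * w t) \<longlongrightarrow> 0) at_top" and "t > T"
  shows "w t = 0"
  using assms
proof (induction cs arbitrary: w t)
  case (Cons c cs)
  let ?y = "foldr shifted_deriv cs w"
  have y: "smooth_pos ?y" by (rule smooth_pos_shifted_derivs[OF Cons.prems(1)])
  have shift: "w (t + h) = of_real (exp (- c * h)) * w t" if h: "h \<ge> 0" and t: "t > T" for t h
  proof -
    \<comment> \<open>The factor \<open>1\<close> puts the difference into the shape of \<open>shifted_derivs_linear\<close>.\<close>
    let ?D = "\<lambda>t. 1 * w (t + h) + (- of_real (exp (- c * h))) * w t"
    have D: "smooth_pos ?D"
      by (intro smooth_pos_add smooth_pos_mult smooth_pos_const smooth_pos_shift h Cons.prems)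
    have "foldr shifted_deriv cs ?D t = 0" if "t > T" for t
    proof -
      have "foldr shifted_deriv cs ?D t = 1 * foldr shifted_deriv cs (\<lambda>t. w (t + h)) t + (- of_real (exp (- c * h))) * ?y t"
        using that Cons.prems(2) by (intro shifted_derivs_linear smooth_pos_shift h Cons.prems) auto
      also have "foldr shifted_deriv cs (\<lambda>t. w (t + h)) t = ?y (t + h)"
        using that Cons.prems(2) by (intro shifted_derivs_shift h Cons.prems) auto
      also have "?y (t + h) = of_real (exp (- c * h)) * ?y t"
        using Cons.prems(3) by (intro shifted_deriv_zero_exponential[OF y _ Cons.prems(2) that h]) simp
      finally show ?thesis by simp
    qed
    moreover have "((\<lambda>t. of_real (exp (M * t)) * ?D t) \<longlongrightarrow> 0) at_top"
    proof -
      have "((\<lambda>t. of_real (exp (M * (t + h))) * w (t + h)) \<longlongrightarrow> 0) at_top"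
        using filterlim_compose[OF Cons.prems(5), of "\<lambda>t. t + h" at_top]
          filterlim_tendsto_add_at_top[OF tendsto_const[of h] filterlim_ident]
        by (simp add: add.commute)
      then have "((\<lambda>t. of_real (exp (- M * h)) * (of_real (exp (M * (t + h))) * w (t + h))
          + (- of_real (exp (- c * h))) * (of_real (exp (M * t)) * w t))
          \<longlongrightarrow> of_real (exp (- M * h)) * 0 + (- of_real (exp (- c * h))) * 0) at_top"
        by (intro tendsto_intros Cons.prems(5))
      moreover have "of_real (exp (- M * h)) * (of_real (exp (M * (t + h))) * w (t + h))
          + (- of_real (exp (- c * h))) * (of_real (exp (M * t)) * w t) = of_real (exp (M * t)) * ?D t" for t
      proof -
        have "exp (M * t) = exp (- M * h) * exp (M * (t + h))"
          by (simp add: algebra_simps flip: exp_add)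
        then show ?thesis by (simp add: algebra_simps)
      qed
      ultimately show ?thesis by simp
    qed
    ultimately have "?D t = 0"
      using Cons.prems(4) t by (intro Cons.IH[OF D Cons.prems(2)]) auto
    then show ?thesis by simp
  qed
  have "norm (w t) \<le> 0"
  proof (rule tendsto_lowerbound)
    have "((\<lambda>h. of_real (exp (M * (t + h))) * w (t + h)) \<longlongrightarrow> 0) at_top"
      using filterlim_compose[OF Cons.prems(5), of "\<lambda>h. t + h" at_top]
        filterlim_tendsto_add_at_top[OF tendsto_const[of t] filterlim_ident]
      by simp
    then have "((\<lambda>h. exp (- M * t) * norm (of_real (exp (M * (t + h))) * w (t + h))) \<longlongrightarrow> exp (- M * t) * norm (0::complex)) at_top"
      by (intro tendsto_intros)
    then show "((\<lambda>h. exp (- M * t) * norm (of_real (exp (M * (t + h))) * w (t + h))) \<longlongrightarrow> 0) at_top"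
      by simp
    show "\<forall>\<^sub>F h in at_top. norm (w t) \<le> exp (- M * t) * norm (of_real (exp (M * (t + h))) * w (t + h))"
      using eventually_ge_at_top[of 0]
    proof eventually_elim
      case (elim h)
      have "exp (- M * t) * norm (of_real (exp (M * (t + h))) * w (t + h))
          = exp ((M - c) * h) * norm (w t)"
        unfolding shift[OF elim Cons.prems(6)]
        by (simp add: norm_mult mult.assoc[symmetric] flip: exp_add) (simp add: algebra_simps)
      moreover have "exp ((M - c) * h) \<ge> 1"
        using Cons.prems(4)[of c] elim by simp
      ultimately show ?case
        using mult_right_mono[of 1 "exp ((M - c) * h)" "norm (w t)"] by simp
    qed
  qed simp
  then show ?case by simp
qed simp

section \<open>Spherical means of twisted derivatives\<close>

text \<open>With \<open>x = (- mu j / 4, Inl j)\<close> this is \<open>Z_op mu j\<close>, and with \<open>x = (mu j / 4, Inr j)\<close> it is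
  \<open>Zstar_op mu j\<close>. In both cases the zero-order term multiplies by the coordinate conjugate to the one
  in which the derivative is taken.\<close>

definition twisted_deriv :: "real \<times> ('n + 'n) \<Rightarrow> (complex^'n::finite \<Rightarrow> complex) \<Rightarrow> complex^'n \<Rightarrow> complex" where
  "twisted_deriv x F z = wirt (snd x) F z + of_real (fst x) * zeta (conj_index (snd x)) z * F z"

text \<open>Away from the origin, finite sums of radial profiles times polynomials. The class is stable under
  the twisted derivatives, which makes all functions that occur in their compositions differentiable
  and integrable over spheres. The value at the origin is left free: a profile need not extend
  smoothly to \<open>t = 0\<close>, and a single point does not affect spherical means.\<close>

inductive radial_poly :: "(complex^'n::finite \<Rightarrow> complex) \<Rightarrow> bool" where
  radial_poly_base: "smooth_pos \<phi> \<Longrightarrow> hpoly M R \<Longrightarrow> radial_poly (\<lambda>z. \<phi> ((norm z)\<^sup>2) * R z)"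
| radial_poly_add: "radial_poly F \<Longrightarrow> radial_poly G \<Longrightarrow> radial_poly (\<lambda>z. F z + G z)"
| radial_poly_cong: "radial_poly F \<Longrightarrow> (\<And>z. z \<noteq> 0 \<Longrightarrow> F z = G z) \<Longrightarrow> radial_poly G"

lemma has_vderiv_norm: "smooth_pos \<phi> \<Longrightarrow> z \<noteq> 0 \<Longrightarrow>
    (\<phi> has_vector_derivative vderiv \<phi> ((norm z)\<^sup>2)) (at ((norm z)\<^sup>2))"
  by (rule has_vderiv) simp_all

lemma radial_differentiable:
  "smooth_pos \<phi> \<Longrightarrow> z \<noteq> 0 \<Longrightarrow> (\<lambda>z::complex^'n::finite. \<phi> ((norm z)\<^sup>2)) differentiable (at z)"
  using has_derivative_radial[OF has_vderiv_norm] by (auto simp: differentiable_def)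

lemma twisted_deriv_cong_open:
  assumes "open S" "z \<in> S" "\<And>w. w \<in> S \<Longrightarrow> F w = G w"
  shows "twisted_deriv x F z = twisted_deriv x G z"
  using wirt_cong_open[OF assms] assms(2,3) by (simp add: twisted_deriv_def)

lemma twisted_derivs_cong_open:
  assumes "open S" "z \<in> S" "\<And>w. w \<in> S \<Longrightarrow> F w = G w"
  shows "foldr twisted_deriv xs F z = foldr twisted_deriv xs G z"
  using assms(2)
proof (induction xs arbitrary: z)
  case (Cons x xs)
  show ?case using twisted_deriv_cong_open[OF assms(1) Cons.prems Cons.IH, where x = x] by simp
qed (simp add: assms(3))

lemma open_nonzero: "open (- {0::complex^'n::finite})"
  by (simp add: open_Compl)

lemma radial_poly_differentiable: "radial_poly F \<Longrightarrow> z \<noteq> 0 \<Longrightarrow> F differentiable (at z)"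
proof (induction rule: radial_poly.induct)
  case (radial_poly_base \<phi> M R)
  from differentiable_mult[OF radial_differentiable[OF radial_poly_base(1,3)] hpoly_differentiable[OF radial_poly_base(2)]]
  show ?case .
next
  case (radial_poly_add F G)
  then show ?case by (simp add: differentiable_add)
next
  case (radial_poly_cong F G)
  then obtain F' where "(F has_derivative F') (at z)" unfolding differentiable_def by blast
  from has_derivative_transform_within_open[OF this open_nonzero, of G]
  have "(G has_derivative F') (at z)" using radial_poly_cong.hyps(2) radial_poly_cong.prems by simp
  then show ?case unfolding differentiable_def by blast
qed

text \<open>On a radial factor a twisted derivative acts as a shifted derivative of the profile, together with
  multiplication by the conjugate coordinate; on a polynomial factor it acts as the plain derivative.\<close>

lemma twisted_deriv_radial_mult:
  assumes "smooth_pos \<phi>" "hpoly M R" "z \<noteq> 0"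
  shows "twisted_deriv x (\<lambda>z. \<phi> ((norm z)\<^sup>2) * R z) z
    = shifted_deriv (fst x) \<phi> ((norm z)\<^sup>2) * (zeta (conj_index (snd x)) z * R z) + \<phi> ((norm z)\<^sup>2) * wirt (snd x) R z"
  unfolding twisted_deriv_def wirt_mult[OF radial_differentiable[OF assms(1,3)] hpoly_differentiable[OF assms(2)]]
    wirt_radial[OF has_vderiv_norm[OF assms(1,3)]]
  by (simp add: shifted_deriv_def algebra_simps)

lemma twisted_deriv_add:
  assumes "F differentiable (at z)" "G differentiable (at z)"
  shows "twisted_deriv x (\<lambda>z. F z + G z) z = twisted_deriv x F z + twisted_deriv x G z"
  by (simp add: twisted_deriv_def wirt_add[OF assms] algebra_simps)

lemma radial_poly_twisted_deriv: "radial_poly F \<Longrightarrow> radial_poly (twisted_deriv x F)"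
proof (induction rule: radial_poly.induct)
  case (radial_poly_base \<phi> M R)
  have "radial_poly (\<lambda>z. shifted_deriv (fst x) \<phi> ((norm z)\<^sup>2) * (zeta (conj_index (snd x)) z * R z)
      + \<phi> ((norm z)\<^sup>2) * wirt (snd x) R z)"
    by (rule radial_poly_add[OF radial_poly.radial_poly_base[OF smooth_pos_shifted_deriv[OF radial_poly_base(1)] hpoly_zeta[OF radial_poly_base(2)]]
          radial_poly.radial_poly_base[OF radial_poly_base(1) hpoly_wirt[OF radial_poly_base(2)]]])
  then show ?case
    by (rule radial_poly_cong) (rule twisted_deriv_radial_mult[OF radial_poly_base, symmetric])
next
  case (radial_poly_add F G)
  show ?case
  proof (rule radial_poly_cong[OF radial_poly.radial_poly_add[OF radial_poly_add.IH]])
    fix z :: "complex^'a" assume "z \<noteq> 0"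
    then show "twisted_deriv x F z + twisted_deriv x G z = twisted_deriv x (\<lambda>z. F z + G z) z"
      using radial_poly_add.hyps by (simp add: twisted_deriv_add radial_poly_differentiable)
  qed
next
  case (radial_poly_cong F G)
  show ?case
  proof (rule radial_poly.radial_poly_cong[OF radial_poly_cong.IH])
    fix z :: "complex^'a" assume "z \<noteq> 0"
    then show "twisted_deriv x F z = twisted_deriv x G z"
      using twisted_deriv_cong_open[OF open_nonzero, of z F G] radial_poly_cong.hyps(2) by simp
  qed
qed

lemma radial_poly_twisted_derivs: "radial_poly F \<Longrightarrow> radial_poly (foldr twisted_deriv xs F)"
  by (induction xs) (auto intro: radial_poly_twisted_deriv)

lemma twisted_derivs_add:
  assumes "radial_poly F" "radial_poly G" "z \<noteq> 0"
  shows "foldr twisted_deriv xs (\<lambda>z. F z + G z) z = foldr twisted_deriv xs F z + foldr twisted_deriv xs G z"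
  using assms(3)
proof (induction xs arbitrary: z)
  case (Cons x xs)
  have "twisted_deriv x (foldr twisted_deriv xs (\<lambda>z. F z + G z)) z = twisted_deriv x (\<lambda>z. foldr twisted_deriv xs F z + foldr twisted_deriv xs G z) z"
    by (rule twisted_deriv_cong_open[OF open_nonzero]) (use Cons in auto)
  then show ?case
    using Cons.prems assms(1,2)
    by (simp add: twisted_deriv_add radial_poly_differentiable radial_poly_twisted_derivs)
qed simp

definition sphere_mean :: "real \<Rightarrow> ('a::euclidean_space \<Rightarrow> complex) \<Rightarrow> complex" where
  "sphere_mean s F = (LINT w|sphere_measure s. F w)"

text \<open>The normalisation map sends the origin of the ball to the origin, but only on a null set.\<close>

lemma emeasure_sphere_measure_0:
  assumes "s > 0"
  shows "emeasure (sphere_measure s :: 'a::euclidean_space measure) {0} = 0"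
proof -
  have "AE w in (sphere_measure s :: 'a measure). w \<noteq> 0"
    using AE_sphere_measure_norm[OF less_imp_le[OF assms]] by eventually_elim (use assms in auto)
  then show ?thesis
    by (subst (asm) AE_iff_measurable[of "{0}"]) auto
qed

lemma sphere_mean_cong:
  assumes "s > 0" "\<And>z::'a::euclidean_space. z \<noteq> 0 \<Longrightarrow> F z = G z"
  shows "sphere_mean s F = sphere_mean s G"
  unfolding sphere_mean_def
  by (rule integral_discrete_difference[of "{0}"]) (use assms in \<open>auto simp: emeasure_sphere_measure_0\<close>)

lemma borel_measurable_continuous_off_0:
  fixes F :: "'a::euclidean_space \<Rightarrow> complex"
  assumes "continuous_on (- {0}) F"
  shows "F \<in> borel_measurable borel"
proof (rule measurable_discrete_difference[of "\<lambda>z. if z \<in> - {0} then F z else 0" _ _ "{0}"])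
  show "(\<lambda>z. if z \<in> - {0} then F z else 0) \<in> borel_measurable borel"
    by (rule borel_measurable_continuous_on_if) (auto intro: assms)
qed auto

lemma radial_poly_measurable: "radial_poly F \<Longrightarrow> F \<in> borel_measurable borel"
  by (intro borel_measurable_continuous_off_0 continuous_at_imp_continuous_on ballI
        differentiable_imp_continuous_within radial_poly_differentiable) auto

lemma hpoly_sphere_measure:
  fixes R :: "complex^'n::finite \<Rightarrow> complex"
  assumes "s > 0" "hpoly M R"
  shows "integrable (sphere_measure s) R" "sphere_mean s R = of_real s ^ M * unit_mean R"
proof -
  have m: "R \<in> borel_measurable borel"
    by (intro borel_measurable_continuous_onI hpoly_continuous_on[OF assms(2)])
  have eq: "(\<lambda>x. R (s *\<^sub>R x)) = (\<lambda>x. of_real s ^ M * R x)"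
    by (simp add: hpoly_homogeneous[OF assms(2)])
  have sc: "(sphere_measure s :: (complex^'n) measure) = distr (sphere_measure 1) borel (\<lambda>x. s *\<^sub>R x)"
    using assms by (intro sphere_measure_scale) simp
  have [measurable]: "(\<lambda>x::complex^'n. s *\<^sub>R x) \<in> borel_measurable borel" by measurable
  show "integrable (sphere_measure s) R"
    unfolding sc by (subst integrable_distr_eq) (use m in \<open>auto simp: eq integrable_hpoly[OF assms(2)]\<close>)
  show "sphere_mean s R = of_real s ^ M * unit_mean R"
    unfolding sc sphere_mean_def by (subst integral_distr) (use m in \<open>auto simp: eq unit_mean_def\<close>)
qed

lemma radial_poly_base_sphere:
  fixes R :: "complex^'n::finite \<Rightarrow> complex"
  assumes s: "s > 0" and "smooth_pos \<phi>" and R: "hpoly M R"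
  shows "integrable (sphere_measure s) (\<lambda>z. \<phi> ((norm z)\<^sup>2) * R z)"
    and "sphere_mean s (\<lambda>z. \<phi> ((norm z)\<^sup>2) * R z) = \<phi> (s\<^sup>2) * (of_real s ^ M * unit_mean R)"
proof -
  let ?F = "\<lambda>z::complex^'n. \<phi> ((norm z)\<^sup>2) * R z"
  have m: "?F \<in> borel_measurable (sphere_measure s)" "(\<lambda>z. \<phi> (s\<^sup>2) * R z) \<in> borel_measurable (sphere_measure s)"
    using radial_poly_measurable[OF radial_poly_base[OF assms(2,3)]] integrable_hpoly[OF R] by auto
  have ae: "AE z in sphere_measure s. ?F z = \<phi> (s\<^sup>2) * R z"
    using AE_sphere_measure_norm[OF less_imp_le[OF s]] by eventually_elim simp
  show "integrable (sphere_measure s) ?F"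
    by (subst integrable_cong_AE[OF m ae]) (simp add: hpoly_sphere_measure[OF s R])
  show "sphere_mean s ?F = \<phi> (s\<^sup>2) * (of_real s ^ M * unit_mean R)"
    unfolding sphere_mean_def integral_cong_AE[OF m ae] using hpoly_sphere_measure(2)[OF s R] by (simp add: sphere_mean_def)
qed

lemma radial_poly_integrable: "radial_poly F \<Longrightarrow> s > 0 \<Longrightarrow> integrable (sphere_measure s) F"
proof (induction rule: radial_poly.induct)
  case (radial_poly_base \<phi> M R)
  then show ?case by (intro radial_poly_base_sphere)
next
  case (radial_poly_cong F G)
  then have "integrable (sphere_measure s) F \<longleftrightarrow> integrable (sphere_measure s) G"
    by (intro integrable_discrete_difference[of "{0}"]) (auto simp: emeasure_sphere_measure_0)
  then show ?case using radial_poly_cong by simp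
qed simp

lemma sphere_mean_add:
  "radial_poly F \<Longrightarrow> radial_poly G \<Longrightarrow> s > 0 \<Longrightarrow> sphere_mean s (\<lambda>z. F z + G z) = sphere_mean s F + sphere_mean s G"
  by (simp add: sphere_mean_def radial_poly_integrable)

lemma twisted_deriv_product:
  assumes "smooth_pos \<phi>" "hpoly M G" "hpoly N H" "z \<noteq> 0"
  shows "twisted_deriv x (\<lambda>z. \<phi> ((norm z)\<^sup>2) * (G z * H z)) z
    = shifted_deriv (fst x) \<phi> ((norm z)\<^sup>2) * ((zeta (conj_index (snd x)) z * G z) * H z)
      + (\<phi> ((norm z)\<^sup>2) * (wirt (snd x) G z * H z) + \<phi> ((norm z)\<^sup>2) * (G z * wirt (snd x) H z))"
  unfolding twisted_deriv_radial_mult[OF assms(1) hpoly_mult[OF assms(2,3)] assms(4)]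
    wirt_mult[OF hpoly_differentiable[OF assms(2)] hpoly_differentiable[OF assms(3)]]
  by (simp add: algebra_simps)

text \<open>The innermost operator acts first and distributes over the three factors.\<close>

lemma sphere_mean_twisted_derivs_snoc:
  fixes G H :: "complex^'n::finite \<Rightarrow> complex"
  assumes \<phi>: "smooth_pos \<phi>" and G: "hpoly M G" and H: "hpoly N H" and s: "s > 0"
  shows "sphere_mean s (foldr twisted_deriv (xs @ [x]) (\<lambda>z. \<phi> ((norm z)\<^sup>2) * (G z * H z)))
    = sphere_mean s (foldr twisted_deriv xs (\<lambda>z. shifted_deriv (fst x) \<phi> ((norm z)\<^sup>2) * ((zeta (conj_index (snd x)) z * G z) * H z)))
    + sphere_mean s (foldr twisted_deriv xs (\<lambda>z. \<phi> ((norm z)\<^sup>2) * (wirt (snd x) G z * H z)))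
    + sphere_mean s (foldr twisted_deriv xs (\<lambda>z. \<phi> ((norm z)\<^sup>2) * (G z * wirt (snd x) H z)))"
proof -
  let ?F1 = "\<lambda>z. shifted_deriv (fst x) \<phi> ((norm z)\<^sup>2) * ((zeta (conj_index (snd x)) z * G z) * H z)"
  let ?F2 = "\<lambda>z. \<phi> ((norm z)\<^sup>2) * (wirt (snd x) G z * H z)"
  let ?F3 = "\<lambda>z. \<phi> ((norm z)\<^sup>2) * (G z * wirt (snd x) H z)"
  have r: "radial_poly ?F1" "radial_poly ?F2" "radial_poly ?F3"
    by (rule radial_poly_base[OF smooth_pos_shifted_deriv[OF \<phi>] hpoly_mult[OF hpoly_zeta[OF G] H]]
        radial_poly_base[OF \<phi> hpoly_mult[OF hpoly_wirt[OF G] H]]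
        radial_poly_base[OF \<phi> hpoly_mult[OF G hpoly_wirt[OF H]]])+
  note r23 = radial_poly_add[OF r(2,3)]
  have "sphere_mean s (foldr twisted_deriv (xs @ [x]) (\<lambda>z. \<phi> ((norm z)\<^sup>2) * (G z * H z)))
      = sphere_mean s (\<lambda>z. foldr twisted_deriv xs ?F1 z + (foldr twisted_deriv xs ?F2 z + foldr twisted_deriv xs ?F3 z))"
  proof (rule sphere_mean_cong[OF s])
    fix z :: "complex^'n" assume z: "z \<noteq> 0"
    have "foldr twisted_deriv (xs @ [x]) (\<lambda>z. \<phi> ((norm z)\<^sup>2) * (G z * H z)) z
        = foldr twisted_deriv xs (\<lambda>z. ?F1 z + (?F2 z + ?F3 z)) z"
      unfolding foldr_append foldr.simps o_def id_def
      by (rule twisted_derivs_cong_open[OF open_nonzero]) (use z in \<open>auto simp: twisted_deriv_product[OF \<phi> G H]\<close>)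
    also have "\<dots> = foldr twisted_deriv xs ?F1 z + (foldr twisted_deriv xs ?F2 z + foldr twisted_deriv xs ?F3 z)"
      by (simp only: twisted_derivs_add[OF r(1) r23 z] twisted_derivs_add[OF r(2,3) z])
    finally show "foldr twisted_deriv (xs @ [x]) (\<lambda>z. \<phi> ((norm z)\<^sup>2) * (G z * H z)) z
        = foldr twisted_deriv xs ?F1 z + (foldr twisted_deriv xs ?F2 z + foldr twisted_deriv xs ?F3 z)" .
  qed
  also have "\<dots> = sphere_mean s (foldr twisted_deriv xs ?F1) + (sphere_mean s (foldr twisted_deriv xs ?F2) + sphere_mean s (foldr twisted_deriv xs ?F3))"
    by (simp add: sphere_mean_add radial_poly_add radial_poly_twisted_derivs r s)
  finally show ?thesis by (simp add: add.assoc)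
qed

text \<open>Each operator raises the degree of \<open>G\<close> by at most one or lowers that of \<open>H\<close> by one. The gap between
  the degrees exceeds the number of operators, so it is still positive at the end and orthogonality
  applies.\<close>

lemma sphere_mean_twisted_derivs_eq_0:
  assumes "smooth_pos \<phi>" "hpoly M G" "harmonic_hpoly N H" "M + length xs < N" "s > 0"
  shows "sphere_mean s (foldr twisted_deriv xs (\<lambda>z. \<phi> ((norm z)\<^sup>2) * (G z * H z))) = 0"
  using assms(1-4)
proof (induction xs arbitrary: \<phi> M G N H rule: rev_induct)
  case Nil
  then show ?case
    using radial_poly_base_sphere(2)[OF assms(5) Nil(1) hpoly_mult[of M G N H]] unit_mean_orthogonal[of M G N H]
    by (simp add: harmonic_hpoly_def)
next
  case (snoc x xs)
  obtain N' where N: "N = Suc N'" using snoc.prems by (cases N) auto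
  have H: "hpoly N H" using snoc.prems by (simp add: harmonic_hpoly_def)
  show ?case
    unfolding sphere_mean_twisted_derivs_snoc[OF snoc.prems(1,2) H assms(5)]
    using snoc.IH[OF smooth_pos_shifted_deriv[OF snoc.prems(1)] hpoly_zeta[OF snoc.prems(2)] snoc.prems(3)]
      snoc.IH[OF snoc.prems(1) hpoly_wirt[OF snoc.prems(2)] snoc.prems(3)]
      snoc.IH[OF snoc.prems(1,2) harmonic_hpoly_wirt[OF snoc.prems(3)[unfolded N]]] snoc.prems(4) N
    by simp
qed

text \<open>The monomial that the operators produce when all derivatives fall on the radial factor; for the
  operator of the theorem it is the conjugate of \<open>z\<^sup>\<alpha>\<close> times \<open>z\<^sup>\<beta>\<close>.\<close>

definition symbol :: "(real \<times> ('n + 'n)) list \<Rightarrow> complex^'n::finite \<Rightarrow> complex" where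
  "symbol xs z = (\<Prod>x\<leftarrow>xs. zeta (conj_index (snd x)) z)"

lemma hpoly_symbol: "hpoly (length xs) (symbol xs)"
proof (induction xs)
  case Nil
  then show ?case using hpoly_const[of 1] by (simp add: symbol_def[abs_def])
next
  case (Cons x xs)
  from hpoly_zeta[OF this] show ?case by (simp add: symbol_def[abs_def])
qed

lemma unit_mean_symbol_snoc:
  fixes H :: "complex^'n::finite \<Rightarrow> complex"
  assumes G: "hpoly M G" and H: "harmonic_hpoly (Suc N) H" and N: "N = M + length xs"
  shows "of_nat (CARD('n) + N) * unit_mean (\<lambda>z. symbol xs z * (zeta (conj_index (snd x)) z * G z) * H z)
    = unit_mean (\<lambda>z. symbol xs z * G z * wirt (snd x) H z)"
  using unit_mean_zeta_pairing[OF hpoly_mult[OF hpoly_symbol[of xs] G, folded add.commute[of M], folded N] H, of "snd x"]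
  by (simp add: mult_ac)

text \<open>The exact formula for the radial projection, when the number of operators equals the gap between
  the degrees. By induction from the innermost operator, of whose three terms the one with a derivative
  of \<open>G\<close> has too low a degree. The other two have proportional constants, with the ratio
  \<open>e + N\<close> given by the pairing of multiplication and differentiation. This ratio is the one with which the
  product rule combines them into the shifted derivative of \<open>t\<^sup>e\<^sup>+\<^sup>N \<phi> t\<close>.\<close>

lemma sphere_mean_twisted_derivs:
  fixes G H :: "complex^'n::finite \<Rightarrow> complex"
  assumes "smooth_pos \<phi>" "hpoly M G" "harmonic_hpoly N H" "M + length xs = N" "s > 0"
    and e: "CARD('n) = Suc e"
  shows "of_real (s\<^sup>2) ^ e * sphere_mean s (foldr twisted_deriv xs (\<lambda>z. \<phi> ((norm z)\<^sup>2) * (G z * H z)))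
    = unit_mean (\<lambda>z. symbol xs z * G z * H z)
      * foldr shifted_deriv (map fst xs) (\<lambda>t. of_real t ^ (e + N) * \<phi> t) (s\<^sup>2)"
  using assms(1-4)
proof (induction xs arbitrary: \<phi> M G N H rule: rev_induct)
  case Nil
  then show ?case
    using radial_poly_base_sphere(2)[OF assms(5) Nil(1) hpoly_mult[of M G N H]]
    by (simp add: harmonic_hpoly_def symbol_def power_add power2_eq_square power_mult_distrib)
next
  case (snoc x xs)
  let ?c = "fst x" and ?i = "snd x" and ?t = "s\<^sup>2"
  let ?X = "unit_mean (\<lambda>z. symbol xs z * (zeta (conj_index ?i) z * G z) * H z)"
  obtain N' where N: "N = Suc N'" using snoc.prems by (cases N) auto
  have N': "N' = M + length xs" using snoc.prems(4) N by simp
  have H: "hpoly N H" "harmonic_hpoly (Suc N') H" using snoc.prems N by (simp_all add: harmonic_hpoly_def)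
  have t: "?t > 0" using assms(5) by simp
  let ?B = "foldr shifted_deriv (map fst xs)"
  have sm1: "smooth_pos (\<lambda>t. of_real t ^ (e + N) * shifted_deriv ?c \<phi> t)"
    by (intro smooth_pos_mult smooth_pos_power smooth_pos_shifted_deriv snoc.prems)
  have sm2: "smooth_pos (\<lambda>t. of_real t ^ (e + N') * \<phi> t)"
    by (intro smooth_pos_mult smooth_pos_power snoc.prems)
  have 1: "of_real ?t ^ e * sphere_mean s (foldr twisted_deriv xs (\<lambda>z. shifted_deriv ?c \<phi> ((norm z)\<^sup>2) * ((zeta (conj_index ?i) z * G z) * H z)))
      = ?X * ?B (\<lambda>t. of_real t ^ (e + N) * shifted_deriv ?c \<phi> t) ?t"
    using snoc.prems(4)
    by (intro snoc.IH[OF smooth_pos_shifted_deriv[OF snoc.prems(1)] hpoly_zeta[OF snoc.prems(2)] snoc.prems(3)]) simp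
  have 2: "sphere_mean s (foldr twisted_deriv xs (\<lambda>z. \<phi> ((norm z)\<^sup>2) * (wirt ?i G z * H z))) = 0"
    using snoc.prems(4)
    by (intro sphere_mean_twisted_derivs_eq_0[OF snoc.prems(1) hpoly_wirt[OF snoc.prems(2)] snoc.prems(3) _ assms(5)]) simp
  have "of_real ?t ^ e * sphere_mean s (foldr twisted_deriv xs (\<lambda>z. \<phi> ((norm z)\<^sup>2) * (G z * wirt ?i H z)))
      = unit_mean (\<lambda>z. symbol xs z * G z * wirt ?i H z) * ?B (\<lambda>t. of_real t ^ (e + N') * \<phi> t) ?t"
    by (rule snoc.IH[OF snoc.prems(1,2) harmonic_hpoly_wirt[OF H(2)] N'[symmetric]])
  also have "unit_mean (\<lambda>z. symbol xs z * G z * wirt ?i H z) = of_nat (e + N) * ?X"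
    using unit_mean_symbol_snoc[OF snoc.prems(2) H(2) N', of x] e N by simp
  finally have 3: "of_real ?t ^ e * sphere_mean s (foldr twisted_deriv xs (\<lambda>z. \<phi> ((norm z)\<^sup>2) * (G z * wirt ?i H z)))
      = of_nat (e + N) * ?X * ?B (\<lambda>t. of_real t ^ (e + N') * \<phi> t) ?t" .
  have "?B (shifted_deriv ?c (\<lambda>t. of_real t ^ (e + N) * \<phi> t)) ?t
      = ?B (\<lambda>t. 1 * (of_real t ^ (e + N) * shifted_deriv ?c \<phi> t) + of_nat (e + N) * (of_real t ^ (e + N') * \<phi> t)) ?t"
  proof (rule shifted_derivs_cong[OF _ _ t])
    show "smooth_pos (shifted_deriv ?c (\<lambda>t. of_real t ^ (e + N) * \<phi> t))"
      by (intro smooth_pos_shifted_deriv smooth_pos_mult smooth_pos_power snoc.prems)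
    fix u :: real assume u: "u > 0"
    have "((\<lambda>t. complex_of_real (t ^ (e + N))) has_vector_derivative of_real (real (e + N) * u ^ (e + N'))) (at u)"
      using DERIV_pow[of "e + N" u UNIV] N by (intro has_vector_derivative_of_real) simp
    from has_vector_derivative_mult[OF this has_vderiv[OF snoc.prems(1) u]]
    show "shifted_deriv ?c (\<lambda>t. of_real t ^ (e + N) * \<phi> t) u
        = 1 * (of_real u ^ (e + N) * shifted_deriv ?c \<phi> u) + of_nat (e + N) * (of_real u ^ (e + N') * \<phi> u)"
      by (simp add: shifted_deriv_def vderiv_eq algebra_simps)
  qed
  also have "\<dots> = 1 * ?B (\<lambda>t. of_real t ^ (e + N) * shifted_deriv ?c \<phi> t) ?t
      + of_nat (e + N) * ?B (\<lambda>t. of_real t ^ (e + N') * \<phi> t) ?t"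
    by (rule shifted_derivs_linear[OF sm1 sm2 t])
  finally have B: "?B (shifted_deriv ?c (\<lambda>t. of_real t ^ (e + N) * \<phi> t)) ?t
      = ?B (\<lambda>t. of_real t ^ (e + N) * shifted_deriv ?c \<phi> t) ?t
      + of_nat (e + N) * ?B (\<lambda>t. of_real t ^ (e + N') * \<phi> t) ?t" by simp
  have sy: "(\<lambda>z. symbol (xs @ [x]) z * G z * H z) = (\<lambda>z. symbol xs z * (zeta (conj_index ?i) z * G z) * H z)"
    by (simp add: symbol_def mult_ac)
  show ?case
    unfolding sphere_mean_twisted_derivs_snoc[OF snoc.prems(1,2) H(1) assms(5)] 2 sy
    using B by (simp only: distrib_left 1 3 map_append list.map foldr_append foldr.simps o_def id_def)
      (simp add: algebra_simps)
qed

text \<open>The factors of the symbol are moved onto \<open>H\<close> as derivatives, one at a time, at the cost of positive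
  constants. As their number equals the degree of \<open>H\<close>, a constant function is left.\<close>

lemma unit_mean_symbol_nonzero:
  fixes H :: "complex^'n::finite \<Rightarrow> complex"
  assumes "harmonic_hpoly (length xs) H"
  shows "unit_mean (\<lambda>z. symbol xs z * H z) \<noteq> 0 \<longleftrightarrow> foldr wirt (map snd xs) H 0 \<noteq> 0"
  using assms
proof (induction xs arbitrary: H rule: rev_induct)
  case Nil
  then obtain c where "H = (\<lambda>z. c)" using hpoly_0_const[of H] by (auto simp: harmonic_hpoly_def)
  then show ?case by (simp add: symbol_def)
next
  case (snoc x xs)
  then have H: "harmonic_hpoly (Suc (length xs)) H" by simp
  have "of_nat (CARD('n) + length xs) * unit_mean (\<lambda>z. symbol (xs @ [x]) z * H z)
      = unit_mean (\<lambda>z. symbol xs z * wirt (snd x) H z)"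
    using unit_mean_symbol_snoc[OF hpoly_const[of 1] H, of xs x] by (simp add: symbol_def)
  moreover have "of_nat (CARD('n) + length xs) \<noteq> (0::complex)"
    by (subst of_nat_eq_0_iff) simp
  ultimately show ?case
    using snoc.IH[OF harmonic_hpoly_wirt[OF H], of "snd x"] by auto
qed

section \<open>The operator \<open>P\<close> and its lowest coefficient\<close>

definition zmonomial :: "('n + 'n \<Rightarrow> nat) \<Rightarrow> complex^'n::finite \<Rightarrow> complex" where
  "zmonomial e z = (\<Prod>i\<in>UNIV. zeta i z ^ e i)"

lemma hpoly_zeta_power: "hpoly m (\<lambda>z. zeta i z ^ m)"
  using hpoly_power[OF hpoly_zeta_self, of m i] by simp

lemma hpoly_zmonomial: "hpoly (\<Sum>i\<in>UNIV. e i) (zmonomial e)"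
  unfolding zmonomial_def by (rule hpoly_prod[OF hpoly_zeta_power]) simp

lemma zeta_power_differentiable: "(\<lambda>z. zeta i z ^ m) differentiable (at z)"
  by (rule hpoly_differentiable[OF hpoly_zeta_power])

lemma wirt_zeta_power:
  "wirt k (\<lambda>z. zeta i z ^ m) z = of_bool (k = i) * (of_nat m * zeta i z ^ (m - 1))"
proof (induction m)
  case (Suc m)
  have "wirt k (\<lambda>z. zeta i z * zeta i z ^ m) z
      = of_bool (k = i) * zeta i z ^ m + zeta i z * (of_bool (k = i) * (of_nat m * zeta i z ^ (m - 1)))"
    by (simp only: wirt_zeta_mult[OF zeta_power_differentiable] Suc)
  also have "\<dots> = of_bool (k = i) * (of_nat (Suc m) * zeta i z ^ m)"
    by (cases m) (auto simp: algebra_simps)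
  finally show ?case by simp
qed simp

lemma wirt_prod_others:
  assumes "finite S" "k \<notin> S"
  shows "wirt k (\<lambda>z. \<Prod>i\<in>S. zeta i z ^ e i) z = 0"
  using assms
proof (induction S)
  case (insert i S)
  have d: "(\<lambda>z. \<Prod>i\<in>S. zeta i z ^ e i) differentiable (at z)"
    by (rule hpoly_differentiable[OF hpoly_prod[OF hpoly_zeta_power insert.hyps(1)]])
  show ?case
    using insert by (simp add: wirt_mult[OF zeta_power_differentiable d] wirt_zeta_power)
qed simp

lemma wirt_zmonomial: "wirt k (zmonomial e) z = of_nat (e k) * zmonomial (e(k := e k - 1)) z"
proof -
  let ?R = "\<lambda>z. \<Prod>i\<in>UNIV - {k}. zeta i z ^ e i"
  have split: "zmonomial e' z = zeta k z ^ e' k * (\<Prod>i\<in>UNIV - {k}. zeta i z ^ e' i)" for e' z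
    unfolding zmonomial_def by (rule prod.remove) simp_all
  have d: "?R differentiable (at z)"
    by (rule hpoly_differentiable[OF hpoly_prod[OF hpoly_zeta_power]]) simp
  have "zmonomial e = (\<lambda>z. zeta k z ^ e k * ?R z)" by (rule ext) (rule split)
  then have "wirt k (zmonomial e) z = of_nat (e k) * (zeta k z ^ (e k - 1) * ?R z)"
    by (simp add: wirt_mult[OF zeta_power_differentiable d] wirt_zeta_power wirt_prod_others)
  also have "zeta k z ^ (e k - 1) * ?R z = zmonomial (e(k := e k - 1)) z"
    unfolding split[of "e(k := e k - 1)"] by (intro arg_cong2[of _ _ _ _ "(*)"] prod.cong) auto
  finally show ?thesis .
qed

lemma wirt_cmult: "f differentiable (at z) \<Longrightarrow> wirt i (\<lambda>z. c * f z) z = c * wirt i f z"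
  by (simp add: wirt_mult[of "\<lambda>z. c"])

lemma hpoly_foldr_wirt: "hpoly M G \<Longrightarrow> hpoly (M - length ks) (foldr wirt ks G)"
proof (induction ks)
  case (Cons k ks)
  from hpoly_wirt[OF Cons.IH[OF Cons.prems], of k] show ?case by simp
qed simp

lemma foldr_wirt_sum:
  assumes "finite S" "\<And>x. x \<in> S \<Longrightarrow> hpoly M (G x)"
  shows "foldr wirt ks (\<lambda>z. \<Sum>x\<in>S. c x * G x z) = (\<lambda>z. \<Sum>x\<in>S. c x * foldr wirt ks (G x) z)"
proof (induction ks)
  case (Cons k ks)
  have h: "hpoly (M - length ks) (foldr wirt ks (G x))" if "x \<in> S" for x
    by (rule hpoly_foldr_wirt[OF assms(2)[OF that]])
  have "wirt k (\<lambda>z. c x * foldr wirt ks (G x) z) z = c x * wirt k (foldr wirt ks (G x)) z" if "x \<in> S" for x z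
    by (rule wirt_cmult[OF hpoly_differentiable[OF h[OF that]]])
  then show ?case
    by (simp add: Cons fun_eq_iff wirt_sum[OF hpoly_cmult[OF h] assms(1)])
qed simp

text \<open>\<open>K\<close> is a product of falling factorials. It is zero as soon as one variable is differentiated more
  often than it occurs, and then the truncated subtraction in the exponent is irrelevant.\<close>

lemma foldr_wirt_zmonomial:
  "\<exists>K. foldr wirt ks (zmonomial e) = (\<lambda>z. K * zmonomial (\<lambda>i. e i - count_list ks i) z)
    \<and> (K \<noteq> 0 \<longleftrightarrow> (\<forall>i. count_list ks i \<le> e i))"
proof (induction ks)
  case Nil
  show ?case by (intro exI[of _ 1]) simp
next
  case (Cons k ks)
  let ?e = "\<lambda>i. e i - count_list ks i"
  from Cons.IH obtain K where K': "foldr wirt ks (zmonomial e) = (\<lambda>z. K * zmonomial ?e z)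
      \<and> (K \<noteq> 0 \<longleftrightarrow> (\<forall>i. count_list ks i \<le> e i))" ..
  note K = conjunct1[OF K'] conjunct2[OF K']
  have upd: "?e(k := ?e k - 1) = (\<lambda>i. e i - count_list (k # ks) i)"
    by (rule ext) simp
  have "foldr wirt (k # ks) (zmonomial e) = (\<lambda>z. (K * of_nat (?e k)) * zmonomial (\<lambda>i. e i - count_list (k # ks) i) z)"
  proof
    fix z
    have "wirt k (\<lambda>z. K * zmonomial ?e z) z = K * wirt k (zmonomial ?e) z"
      by (rule wirt_cmult[OF hpoly_differentiable[OF hpoly_zmonomial]])
    then show "foldr wirt (k # ks) (zmonomial e) z = (K * of_nat (?e k)) * zmonomial (\<lambda>i. e i - count_list (k # ks) i) z"
      unfolding foldr.simps o_def K(1) by (simp only: wirt_zmonomial upd mult.assoc)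
  qed
  moreover have "K * of_nat (?e k) \<noteq> 0 \<longleftrightarrow> (\<forall>i. count_list (k # ks) i \<le> e i)"
  proof
    assume "K * of_nat (?e k) \<noteq> 0"
    then have "K \<noteq> 0" "?e k \<noteq> 0" by simp_all
    then have "count_list ks i \<le> e i" "count_list ks k < e k" for i using K(2) by simp_all
    then show "\<forall>i. count_list (k # ks) i \<le> e i" by simp
  next
    assume a: "\<forall>i. count_list (k # ks) i \<le> e i"
    have "count_list ks i \<le> e i" for i
      using a[rule_format, of i] by (simp split: if_splits)
    then have "K \<noteq> 0" using K(2) by simp
    moreover have "count_list ks k < e k" using a[rule_format, of k] by simp
    ultimately show "K * of_nat (?e k) \<noteq> 0" by simp
  qed
  ultimately show ?case by (intro exI[of _ "K * of_nat (?e k)"] conjI)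
qed

lemma finite_multi_indices: "finite (multi_indices p :: ('n::finite \<Rightarrow> nat) set)"
proof (rule finite_subset)
  show "(multi_indices p :: ('n \<Rightarrow> nat) set) \<subseteq> PiE UNIV (\<lambda>_. {..p})"
    by (auto simp: multi_indices_def PiE_def intro!: member_le_sum)
qed (auto intro: finite_PiE)

lemma bihom_poly_zmonomial:
  "bihom_poly p q c = (\<lambda>z. \<Sum>x\<in>multi_indices p \<times> multi_indices q.
      c (fst x) (snd x) * zmonomial (case_sum (fst x) (snd x)) z)"
proof
  fix z :: "complex^'a"
  have "zmonomial (case_sum \<alpha> \<beta>) z = (\<Prod>j\<in>UNIV. z $ j ^ \<alpha> j) * (\<Prod>j\<in>UNIV. cnj (z $ j) ^ \<beta> j)" for \<alpha> \<beta>
    using prod.Plus[of "UNIV :: 'a set" "UNIV :: 'a set" "\<lambda>i. zeta i z ^ case_sum \<alpha> \<beta> i"]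
    by (simp add: zmonomial_def zeta_def o_def)
  then show "bihom_poly p q c z = (\<Sum>x\<in>multi_indices p \<times> multi_indices q.
      c (fst x) (snd x) * zmonomial (case_sum (fst x) (snd x)) z)"
    by (simp add: bihom_poly_def sum.cartesian_product case_prod_beta' mult.assoc)
qed

lemma hpoly_zmonomial_case_sum:
  assumes "\<alpha> \<in> multi_indices p" "\<beta> \<in> multi_indices q"
  shows "hpoly (p + q) (zmonomial (case_sum \<alpha> \<beta>))"
  using hpoly_zmonomial[of "case_sum \<alpha> \<beta>"] assms by (simp add: sum_UNIV_sum multi_indices_def)

lemma hpoly_bihom_poly: "hpoly (p + q) (bihom_poly p q c)"
  unfolding bihom_poly_zmonomial
  by (intro hpoly_sum hpoly_cmult hpoly_zmonomial_case_sum) auto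

text \<open>The number of derivatives equals the degree, so each monomial with other exponents is
  differentiated too often in some variable; what is left is \<open>c \<alpha> \<beta>\<close> times factorials.\<close>

lemma occurs_in_foldr_wirt:
  assumes "occurs_in p q Q \<alpha> \<beta>" "\<And>i. count_list ks i = case_sum \<alpha> \<beta> i"
  shows "foldr wirt ks Q 0 \<noteq> 0"
proof -
  from assms(1) obtain c where ab: "\<alpha> \<in> multi_indices p" "\<beta> \<in> multi_indices q"
    and Q: "Q = bihom_poly p q c" and c: "c \<alpha> \<beta> \<noteq> 0"
    by (auto simp: occurs_in_def)
  let ?S = "multi_indices p \<times> multi_indices q" and ?e = "\<lambda>x. case_sum (fst x) (snd x)"
  have fin: "finite ?S" by (simp add: finite_multi_indices)
  have "foldr wirt ks Q = (\<lambda>z. \<Sum>x\<in>?S. c (fst x) (snd x) * foldr wirt ks (zmonomial (?e x)) z)"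
    unfolding Q bihom_poly_zmonomial
    by (rule foldr_wirt_sum[OF fin]) (auto intro: hpoly_zmonomial_case_sum)
  then have "foldr wirt ks Q 0 = (\<Sum>x\<in>?S. c (fst x) (snd x) * foldr wirt ks (zmonomial (?e x)) 0)" by simp
  also have "\<dots> = (\<Sum>x\<in>{(\<alpha>, \<beta>)}. c (fst x) (snd x) * foldr wirt ks (zmonomial (?e x)) 0)"
  proof (rule sum.mono_neutral_right[OF fin])
    show "\<forall>x\<in>?S - {(\<alpha>, \<beta>)}. c (fst x) (snd x) * foldr wirt ks (zmonomial (?e x)) 0 = 0"
    proof
      fix x assume x: "x \<in> ?S - {(\<alpha>, \<beta>)}"
      have "\<not> (\<forall>i. count_list ks i \<le> ?e x i)"
      proof
        assume le: "\<forall>i. count_list ks i \<le> ?e x i"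
        have "(\<Sum>i\<in>UNIV. count_list ks i) = (\<Sum>i\<in>UNIV. ?e x i)"
          using x ab by (auto simp: assms(2) sum_UNIV_sum multi_indices_def)
        then have "count_list ks i = ?e x i" for i
          using sum_mono_inv[of "count_list ks" UNIV "?e x" i] le by simp
        then have "?e x i = case_sum \<alpha> \<beta> i" for i using assms(2) by simp
        then have "fst x j = \<alpha> j" "snd x j = \<beta> j" for j
          using sum.case by metis+
        then have "x = (\<alpha>, \<beta>)" by (simp add: prod_eq_iff fun_eq_iff)
        with x show False by simp
      qed
      then show "c (fst x) (snd x) * foldr wirt ks (zmonomial (?e x)) 0 = 0"
        using foldr_wirt_zmonomial[of ks "?e x"] by auto
    qed
  qed (use ab in auto)
  also have "\<dots> = c \<alpha> \<beta> * foldr wirt ks (zmonomial (case_sum \<alpha> \<beta>)) 0" by simp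
  also have "\<dots> \<noteq> 0"
  proof -
    obtain K where "foldr wirt ks (zmonomial (case_sum \<alpha> \<beta>)) = (\<lambda>z. K * zmonomial (\<lambda>i. case_sum \<alpha> \<beta> i - count_list ks i) z)"
      "K \<noteq> 0"
      using foldr_wirt_zmonomial[of ks "case_sum \<alpha> \<beta>"] assms(2) by auto
    then show ?thesis using c by (simp add: assms(2) zmonomial_def)
  qed
  finally show ?thesis .
qed

lemma dir_deriv_wirt:
  "dir_deriv (axis j 1) f z = wirt (Inl j) f z + wirt (Inr j) f z"
  "dir_deriv (axis j \<i>) f z = \<i> * wirt (Inl j) f z + (- \<i>) * wirt (Inr j) f z"
  by (auto simp: wirt_def d_z_def d_zbar_def field_simps)

text \<open>In the sum of the two real second derivatives in one complex variable the pure terms in \<open>z\<close> or in its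
  conjugate cancel; the mixed ones occur in both orders.\<close>

lemma laplacian_wirt:
  assumes Q: "hpoly M Q"
  shows "laplacian Q z = 2 * (\<Sum>i\<in>UNIV. wirt (conj_index i) (wirt i Q) z)"
proof -
  have lin: "wirt k (\<lambda>z. a * wirt i Q z + b * wirt l Q z) z = a * wirt k (wirt i Q) z + b * wirt k (wirt l Q) z"
    for k i l a b z
  proof -
    have d: "(\<lambda>z. c * wirt i Q z) differentiable (at z)" for c i
      by (rule hpoly_differentiable[OF hpoly_cmult[OF hpoly_wirt[OF Q]]])
    have "wirt k (\<lambda>z. c * wirt i Q z) z = c * wirt k (wirt i Q) z" for c i
      by (rule wirt_cmult[OF hpoly_differentiable[OF hpoly_wirt[OF Q]]])
    then show ?thesis by (simp add: wirt_add[OF d d])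
  qed
  have lin1: "wirt k (\<lambda>z. wirt i Q z + wirt l Q z) z = wirt k (wirt i Q) z + wirt k (wirt l Q) z" for k i l z
    using lin[of k 1 i 1 l z] by simp
  have "dir_deriv (axis j 1) (dir_deriv (axis j 1) Q) z + dir_deriv (axis j \<i>) (dir_deriv (axis j \<i>) Q) z
      = 2 * wirt (Inr j) (wirt (Inl j) Q) z + 2 * wirt (Inl j) (wirt (Inr j) Q) z" for j
    unfolding dir_deriv_wirt lin lin1 by (simp add: algebra_simps)
  then show ?thesis
    by (simp add: laplacian_def sum_Basis_complex_vec sum_UNIV_sum conj_index_def sum.distrib sum_distrib_left)
qed

lemma H_space_harmonic_hpoly:
  assumes "Q \<in> H_space p q"
  shows "harmonic_hpoly (p + q) Q"
proof -
  obtain c where Q: "Q = bihom_poly p q c" and lap: "\<And>z. laplacian Q z = 0"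
    using assms by (auto simp: H_space_def)
  have "hpoly (p + q) Q" unfolding Q by (rule hpoly_bihom_poly)
  with lap laplacian_wirt[OF this] show ?thesis by (simp add: harmonic_hpoly_def)
qed

text \<open>The factors of \<open>P_op\<close>, outermost first, in the form in which \<open>foldr twisted_deriv\<close> composes them.\<close>

definition op_list :: "('n::{finite,linorder} \<Rightarrow> real) \<Rightarrow> ('n \<Rightarrow> nat) \<Rightarrow> ('n \<Rightarrow> nat) \<Rightarrow> (real \<times> ('n + 'n)) list" where
  "op_list mu \<alpha> \<beta> =
     concat (map (\<lambda>j. replicate (\<alpha> j) (- mu j / 4, Inl j)) (sorted_list_of_set UNIV)) @
     concat (map (\<lambda>j. replicate (\<beta> j) (mu j / 4, Inr j)) (sorted_list_of_set UNIV))"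

lemma foldr_twisted_deriv_concat_replicate:
  "foldr twisted_deriv (concat (map (\<lambda>j. replicate (\<alpha> j) (g j)) L)) f = foldr (\<lambda>j. twisted_deriv (g j) ^^ \<alpha> j) L f"
proof (induction L)
  case (Cons j L)
  have "foldr twisted_deriv (replicate m x) h = (twisted_deriv x ^^ m) h" for m x h
    by (induction m) auto
  then show ?case using Cons by simp
qed simp

lemma P_op_eq_twisted_derivs: "P_op mu \<alpha> \<beta> f = foldr twisted_deriv (op_list mu \<alpha> \<beta>) f"
proof -
  have "Z_op mu j = twisted_deriv (- mu j / 4, Inl j)" "Zstar_op mu j = twisted_deriv (mu j / 4, Inr j)" for j
    by (auto simp: fun_eq_iff Z_op_def Zstar_op_def twisted_deriv_def wirt_def zeta_def conj_index_def)
  then show ?thesis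
    by (simp add: P_op_def op_list_def foldr_twisted_deriv_concat_replicate)
qed

lemma count_list_replicate: "count_list (replicate m x) y = (if x = y then m else 0)"
  by (induction m) auto

lemma count_list_concat_replicate:
  assumes "inj g" "distinct L"
  shows "count_list (concat (map (\<lambda>j. replicate (\<alpha> j) (g j)) L)) (g k) = (if k \<in> set L then \<alpha> k else 0)"
  using assms(2) by (induction L) (auto simp: count_list_replicate dest: injD[OF assms(1)])

lemma count_list_op_list: "count_list (map snd (op_list mu \<alpha> \<beta>)) i = case_sum \<alpha> \<beta> i"
proof -
  have 0: "count_list (concat (map (\<lambda>j. replicate (\<gamma> j) (g j)) L)) i = 0" if "\<And>j. g j \<noteq> i"
    for \<gamma> L i and g :: "'a \<Rightarrow> 'a + 'a"
    by (induction L) (auto simp: count_list_replicate that)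
  show ?thesis
    by (cases i)
       (simp_all add: op_list_def map_concat o_def 0
          count_list_concat_replicate[of Inl] count_list_concat_replicate[of Inr])
qed

lemma length_op_list:
  assumes "\<alpha> \<in> multi_indices p" "\<beta> \<in> multi_indices q"
  shows "length (op_list mu \<alpha> \<beta>) = p + q"
  using assms
  by (simp add: op_list_def length_concat o_def sum_list_distinct_conv_sum_set multi_indices_def)

text \<open>The eigenvalues decrease along the index order, so the first one is the largest.\<close>

lemma fst_op_list_le:
  assumes "antimono mu" "\<And>j. mu j > 0" "c \<in> set (map fst (op_list mu \<alpha> \<beta>))"
  shows "c \<le> mu (Min UNIV) / 4"
proof -
  have m: "mu j \<le> mu (Min UNIV)" for j
    by (rule antimonoD[OF assms(1)]) simp
  obtain j where "c = - mu j / 4 \<or> c = mu j / 4"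
    using assms(3) by (auto simp: op_list_def) blast+
  then show ?thesis using m[of j] assms(2)[of j] by auto
qed

lemma orthogonal_transformation_twist:
  fixes A :: "real^('n::finite + 'n)^('n + 'n)"
  assumes "orthogonal_matrix A"
  shows "orthogonal_transformation (\<lambda>z. complexify (A *v realify z))"
  unfolding orthogonal_transformation
proof (intro conjI allI)
  have c: "linear (complexify :: _ \<Rightarrow> complex^'n)"
    by (rule linearI) (auto simp: complexify_def vec_eq_iff complex_eq_iff)
  have r: "linear (realify :: complex^'n \<Rightarrow> _)"
    by (rule linearI) (auto simp: realify_def vec_eq_iff split: sum.splits)
  show "linear (\<lambda>z. complexify (A *v realify z))"
    using linear_compose[OF linear_compose[OF r matrix_vector_mul_linear[of A]] c] by (simp add: o_def)
  fix z :: "complex^'n"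
  have nc: "(norm (complexify x))\<^sup>2 = (norm x)\<^sup>2" for x :: "real^('n + 'n)"
    by (simp add: norm_vec_def L2_set_def sum_nonneg sum_UNIV_sum complexify_def cmod_power2 sum.distrib)
  have nr: "(norm (realify z))\<^sup>2 = (norm z)\<^sup>2"
    by (simp add: norm_vec_def L2_set_def sum_nonneg sum_UNIV_sum realify_def cmod_power2 sum.distrib)
  have "orthogonal_transformation ((*v) A)"
    using assms by (simp add: orthogonal_transformation_matrix)
  then have "norm (A *v realify z) = norm (realify z)"
    by (simp add: orthogonal_transformation)
  with nc[of "A *v realify z"] nr show "norm (complexify (A *v realify z)) = norm z"
    by simp
qed

lemma diff_times_sum: "(\<And>x. x \<in> S \<Longrightarrow> diff_times k (g x)) \<Longrightarrow> diff_times k (\<lambda>t. \<Sum>x\<in>S. g x t)"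
  by (induction S rule: infinite_finite_induct) (auto intro: diff_times_const diff_times_add)

text \<open>Each derivative of \<open>f (sqrt t *\<^sub>R u)\<close> is a sum of products of a power of \<open>t\<close> with a directional derivative
  of \<open>f\<close> along the same ray, so the claim reproduces itself.\<close>

lemma diff_times_Ck_ray:
  fixes u :: "'a::euclidean_space"
  shows "Ck k f \<Longrightarrow> diff_times k (\<lambda>t. f (sqrt t *\<^sub>R u))"
proof (induction k arbitrary: f)
  case (Suc k)
  let ?d = "\<lambda>t. \<Sum>b\<in>Basis. (of_real (u \<bullet> b / 2) * of_real (t powr (- 1 / 2))) * dir_deriv b f (sqrt t *\<^sub>R u)"
  show ?case
  proof (rule diff_times_SucI[of _ ?d])
    show "diff_times k ?d"
      using Suc.prems by (intro diff_times_sum diff_times_mult diff_times_const diff_times_powr Suc.IH) auto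
    fix t :: real assume t: "t > 0"
    let ?D = "frechet_derivative f (at (sqrt t *\<^sub>R u))"
    have D: "(f has_derivative ?D) (at (sqrt t *\<^sub>R u))"
      using Suc.prems by (simp add: frechet_derivative_works)
    then have lin: "linear ?D" by (rule has_derivative_linear)
    have "(sqrt has_real_derivative t powr (- 1 / 2) / 2) (at t)"
      using t by (auto intro!: derivative_eq_intros simp: powr_minus powr_half_sqrt field_simps)
    from has_vector_derivative_scaleR[OF this has_vector_derivative_const[of u]]
    have "((\<lambda>t. sqrt t *\<^sub>R u) has_vector_derivative (t powr (- 1 / 2) / 2) *\<^sub>R u) (at t)"
      by simp
    from vector_derivative_diff_chain_within[OF this, of f ?D] D
    have "((\<lambda>t. f (sqrt t *\<^sub>R u)) has_vector_derivative ?D ((t powr (- 1 / 2) / 2) *\<^sub>R u)) (at t)"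
      by (simp add: o_def has_derivative_at_withinI)
    also have "?D ((t powr (- 1 / 2) / 2) *\<^sub>R u) = (t powr (- 1 / 2) / 2) *\<^sub>R ?D (\<Sum>b\<in>Basis. (u \<bullet> b) *\<^sub>R b)"
      by (simp add: linear_scale[OF lin] euclidean_representation)
    also have "\<dots> = ?d t"
      by (simp add: linear_sum[OF lin] linear_scale[OF lin] scaleR_conv_of_real sum_distrib_left mult_ac)
    finally show "((\<lambda>t. f (sqrt t *\<^sub>R u)) has_vector_derivative ?d t) (at t)" .
  qed
qed simp

lemma smooth_pos_ray: "smooth f \<Longrightarrow> smooth_pos (\<lambda>t. f (sqrt t *\<^sub>R u))"
  unfolding smooth_def smooth_pos_def by (blast intro: diff_times_Ck_ray)

section \<open>The support theorem\<close>

lemma hpoly_nonzero_on_sphere: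
  fixes Q :: "complex^'n::finite \<Rightarrow> complex"
  assumes Q: "hpoly N Q" and "Q \<noteq> (\<lambda>z. 0)"
  obtains u where "norm u = 1" "Q u \<noteq> 0"
proof -
  obtain z where z: "Q z \<noteq> 0" using assms(2) by auto
  \<comment> \<open>At the origin any direction serves: if \<open>Q 0 \<noteq> 0\<close>, then \<open>N = 0\<close> and \<open>Q\<close> is constant.\<close>
  define u :: "complex^'n" where "u = (if z = 0 then axis undefined 1 else sgn z)"
  have u: "norm u = 1" "z = norm z *\<^sub>R u"
    by (auto simp: u_def norm_sgn sgn_div_norm)
  have "Q z = of_real (norm z) ^ N * Q u"
    using hpoly_homogeneous[OF Q, of "norm z" u] u(2) by simp
  with z have "Q u \<noteq> 0" by auto
  with u(1) show ?thesis by (rule that)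
qed

text \<open>Along a ray the polynomial factor is a power of \<open>t\<close> times a non-zero constant, and dividing by it
  recovers the profile from \<open>f\<close>.\<close>

lemma radial_profile_smooth:
  fixes f Q :: "complex^'n::finite \<Rightarrow> complex"
  assumes f: "smooth f" and u: "Q u \<noteq> 0" and Q: "hpoly N Q"
    and prod: "\<And>t. t > 0 \<Longrightarrow> f (sqrt t *\<^sub>R v) = a (sqrt t) * Q (sqrt t *\<^sub>R u)"
  shows "smooth_pos (\<lambda>t. a (sqrt t))"
proof (rule smooth_pos_cong)
  let ?g = "\<lambda>t. (inverse (Q u) * of_real (t powr (- (real N / 2)))) * f (sqrt t *\<^sub>R v)"
  show "smooth_pos ?g"
    by (intro smooth_pos_mult smooth_pos_const smooth_pos_powr smooth_pos_ray f)
  fix t :: real assume t: "t > 0"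
  have "of_real (t powr (- (real N / 2))) * of_real (sqrt t) ^ N = (1::complex)"
  proof -
    have "sqrt t ^ N = t powr (real N / 2)"
      using t by (simp add: powr_half_sqrt[symmetric] powr_realpow[symmetric] powr_powr)
    then have "t powr (- (real N / 2)) * sqrt t ^ N = 1"
      using t by (simp add: powr_add[symmetric])
    then show ?thesis by (metis of_real_1 of_real_mult of_real_power)
  qed
  then show "?g t = a (sqrt t)"
    using u by (simp add: prod[OF t] hpoly_homogeneous[OF Q] field_simps)
qed

lemma twisted_derivs_zero: "foldr twisted_deriv xs (\<lambda>z. 0) = (\<lambda>z. 0)"
proof (induction xs)
  case (Cons x xs)
  have "twisted_deriv x (\<lambda>z::complex^'a. 0) = (\<lambda>z. 0)" by (simp add: twisted_deriv_def fun_eq_iff)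
  then show ?case using Cons by simp
qed simp

lemma Pi00_eq_sphere_mean: "Pi00 g z = sphere_mean (norm z) g"
  by (simp add: Pi00_def sphere_mean_def)

text \<open>The sphere over which the mean at \<open>z\<close> is taken stays outside the ball of radius \<open>r\<close>.\<close>

lemma twisted_mean_eq_0:
  fixes F :: "complex^'n::finite \<Rightarrow> complex"
  assumes F: "\<And>w. norm w > r \<Longrightarrow> F w = 0" and r: "r \<ge> 0" and s: "s > r + norm z"
  shows "twisted_mean mu (Pi00 F) s z = 0"
proof -
  have Pi: "Pi00 F w = 0" if "norm w > r" for w
    unfolding Pi00_def
  proof (rule integral_eq_zero_AE)
    show "AE x in sphere_measure (norm w). F x = 0"
      using AE_sphere_measure_norm[OF norm_ge_zero[of w]] by eventually_elim (use F that in auto)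
  qed
  have "s \<ge> 0" using s r norm_ge_zero[of z] by linarith
  show ?thesis
    unfolding twisted_mean_def
  proof (rule integral_eq_zero_AE)
    show "AE w in sphere_measure s. Pi00 F (z - w) *
        exp (\<i> / 2 * of_real (\<Sum>j\<in>UNIV. mu j * Im (z $ j * cnj (w $ j)))) = 0"
      using AE_sphere_measure_norm[OF \<open>s \<ge> 0\<close>]
    proof eventually_elim
      case (elim w)
      have "norm (z - w) > r"
        using norm_triangle_ineq2[of w z] elim s by (simp add: norm_minus_commute)
      then show ?case by (simp add: Pi)
    qed
  qed
qed

text \<open>At the centre the exponential is \<open>1\<close> and the integrand is constant on the sphere. The smooth \<open>h\<close>
  guarantees that this integrand is measurable.\<close>

lemma twisted_mean_at_0:
  fixes F :: "complex^'n::finite \<Rightarrow> complex"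
  assumes h: "smooth_pos h" and F: "\<And>s. s > 0 \<Longrightarrow> sphere_mean s F = h (s\<^sup>2)" and s: "s > 0"
  shows "twisted_mean mu (Pi00 F) s 0 = h (s\<^sup>2)"
proof -
  have "twisted_mean mu (Pi00 F) s 0 = sphere_mean s (\<lambda>w::complex^'n. sphere_mean (norm w) F)"
    by (simp add: twisted_mean_def sphere_mean_def Pi00_eq_sphere_mean)
  also have "\<dots> = sphere_mean s (\<lambda>w::complex^'n. h ((norm w)\<^sup>2) * 1)"
    by (rule sphere_mean_cong[OF s]) (simp add: F)
  also have "\<dots> = h (s\<^sup>2)"
    using radial_poly_base_sphere(2)[OF s h hpoly_const[of 1]] by simp
  finally show ?thesis .
qed

lemma sphere_mean_twisted_derivs_harmonic:
  fixes Q :: "complex^'n::finite \<Rightarrow> complex"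
  assumes \<phi>: "smooth_pos \<phi>" and Q: "harmonic_hpoly (length xs) Q"
    and F: "\<And>z. z \<noteq> 0 \<Longrightarrow> F z = \<phi> ((norm z)\<^sup>2) * Q z" and s: "s > 0" and e: "CARD('n) = Suc e"
  shows "of_real (s\<^sup>2) ^ e * sphere_mean s (foldr twisted_deriv xs F) = unit_mean (\<lambda>z. symbol xs z * Q z)
      * foldr shifted_deriv (map fst xs) (\<lambda>t. of_real t ^ (e + length xs) * \<phi> t) (s\<^sup>2)"
proof -
  have "sphere_mean s (foldr twisted_deriv xs F) = sphere_mean s (foldr twisted_deriv xs (\<lambda>z. \<phi> ((norm z)\<^sup>2) * (1 * Q z)))"
  proof (rule sphere_mean_cong[OF s])
    fix z :: "complex^'n" assume "z \<noteq> 0"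
    then show "foldr twisted_deriv xs F z = foldr twisted_deriv xs (\<lambda>z. \<phi> ((norm z)\<^sup>2) * (1 * Q z)) z"
      by (intro twisted_derivs_cong_open[OF open_nonzero]) (simp_all add: F)
  qed
  then show ?thesis
    using sphere_mean_twisted_derivs[OF \<phi> hpoly_const[of 1] Q _ s e, of xs] by simp
qed

text \<open>The heart of the matter: the means at the centre give the differential equation for
  \<open>t\<^sup>e\<^sup>+\<^sup>N \<phi> t\<close>, because the constant in front is non-zero, and the decay excludes all solutions but
  zero.\<close>

lemma vanishing_of_decaying_profile:
  fixes Q :: "complex^'n::finite \<Rightarrow> complex"
  assumes \<phi>: "smooth_pos \<phi>" and Q: "harmonic_hpoly (length xs) Q"
    and F: "\<And>z. z \<noteq> 0 \<Longrightarrow> F z = \<phi> ((norm z)\<^sup>2) * Q z"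
    and nz: "foldr wirt (map snd xs) Q 0 \<noteq> 0"
    and M: "\<And>c. c \<in> set (map fst xs) \<Longrightarrow> c \<le> M"
    and decay: "\<And>k. ((\<lambda>t. of_real (exp (M * t)) * (of_real t ^ k * \<phi> t)) \<longlongrightarrow> 0) at_top"
    and r: "r \<ge> 0" and van: "\<And>s. s > r \<Longrightarrow> twisted_mean mu (Pi00 (foldr twisted_deriv xs F)) s 0 = 0"
    and t: "t > r\<^sup>2"
  shows "\<phi> t = 0"
proof -
  obtain e where e: "CARD('n) = Suc e" using not0_implies_Suc[of "CARD('n)"] by auto
  let ?w = "\<lambda>t. of_real t ^ (e + length xs) * \<phi> t"
  let ?B = "foldr shifted_deriv (map fst xs) ?w"
  let ?K = "unit_mean (\<lambda>z. symbol xs z * Q z)"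
  have w: "smooth_pos ?w" by (intro smooth_pos_mult smooth_pos_power \<phi>)
  have K: "?K \<noteq> 0" using unit_mean_symbol_nonzero[OF Q] nz by simp
  define h where "h = (\<lambda>t. ?K * ?B t * of_real (t powr (- real e)))"
  have h: "smooth_pos h"
    unfolding h_def by (intro smooth_pos_mult smooth_pos_const smooth_pos_powr smooth_pos_shifted_derivs w)
  have sphere_mean: "sphere_mean s (foldr twisted_deriv xs F) = h (s\<^sup>2)" if s: "s > 0" for s
  proof -
    have "of_real ((s\<^sup>2) powr (- real e)) * of_real (s\<^sup>2) ^ e = (1::complex)"
    proof -
      have "(s\<^sup>2) powr (- real e) * (s\<^sup>2) ^ e = 1"
        using s by (simp add: powr_minus powr_realpow)
      then show ?thesis by (metis of_real_1 of_real_mult of_real_power)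
    qed
    then have "sphere_mean s (foldr twisted_deriv xs F)
        = of_real ((s\<^sup>2) powr (- real e)) * (of_real (s\<^sup>2) ^ e * sphere_mean s (foldr twisted_deriv xs F))"
      by (metis mult.assoc mult_1)
    also have "of_real (s\<^sup>2) ^ e * sphere_mean s (foldr twisted_deriv xs F) = ?K * ?B (s\<^sup>2)"
      by (rule sphere_mean_twisted_derivs_harmonic[OF \<phi> Q F s e])
    finally show ?thesis unfolding h_def by (simp only: mult.commute)
  qed
  have "?B t = 0" if t: "t > r\<^sup>2" for t
  proof -
    have s: "sqrt t > r" "t > 0" "sqrt t > 0"
    proof -
      show "sqrt t > r" using t by (rule real_less_rsqrt)
      show "t > 0" using t zero_le_power2[of r] by linarith
      then show "sqrt t > 0" by simp
    qed
    have "h ((sqrt t)\<^sup>2) = 0"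
      using twisted_mean_at_0[OF h sphere_mean s(3)] van[OF s(1)] by simp
    then show ?thesis using s(2) K by (simp add: h_def)
  qed
  then have "?w t = 0"
    by (rule decaying_solution_zero[OF w zero_le_power2 _ M decay t])
  moreover have "t > 0" using t zero_le_power2[of r] by linarith
  ultimately show ?thesis by simp
qed

theorem theorem3p4:
  fixes U :: "'m::finite \<Rightarrow> real^('n::{finite,linorder} + 'n)^('n + 'n)"
    and G :: "(real^('n + 'n)) \<times> (real^'m) \<Rightarrow> (real^('n + 'n)) \<times> (real^'m)
                \<Rightarrow> (real^('n + 'n)) \<times> (real^'m)"
    and lam :: "real^'m"
    and mu :: "'n \<Rightarrow> real"
    and A :: "real^('n + 'n)^('n + 'n)"
    and p q :: nat
    and r :: real
    and f P :: "complex^('n::{finite,linorder}) \<Rightarrow> complex"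
    and a :: "real \<Rightarrow> complex"
    and \<alpha> \<beta> :: "'n \<Rightarrow> nat"
  assumes "metivier_group U G"
    and "lam \<noteq> 0"
    and "eigenframe (V_mat U lam) mu A"
    and "r \<ge> 0"
    and "smooth f"
    and "\<And>z. f z = a (norm z) * P z"
    and "P \<in> H_lam_space A p q"
    and "\<alpha> \<in> multi_indices p" and "\<beta> \<in> multi_indices q"
    and "twist A P \<noteq> (\<lambda>z. 0) \<Longrightarrow> occurs_in p q (twist A P) \<alpha> \<beta>"
    and "\<And>k::nat. bounded (range (\<lambda>z. complex_of_real
           (norm z ^ k * exp (mu (Min UNIV) / 4 * (norm z)\<^sup>2)) * f z))"
  shows "(\<forall>z s. s > r + norm z \<longrightarrow>
            twisted_mean mu (Pi00 (P_op mu \<alpha> \<beta> (twist A f))) s z = 0)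
         \<longleftrightarrow> closure {z. f z \<noteq> 0} \<subseteq> cball 0 r"
    (is "?L \<longleftrightarrow> ?R")
proof -
  define T where "T = (\<lambda>z::(complex, 'n) vec. complexify (A *v realify z))"
  have mu: "antimono mu" "\<And>j. mu j > 0" and oA: "orthogonal_matrix A"
    using assms(3) by (auto simp: eigenframe_def)
  have T: "orthogonal_transformation T"
    unfolding T_def by (rule orthogonal_transformation_twist[OF oA])
  have lin: "linear T" and nT: "\<And>z. norm (T z) = norm z"
    using T by (auto simp: orthogonal_transformation)
  have tw: "twist A g z = g (T z)" for g z by (simp add: twist_def T_def)
  let ?xs = "op_list mu \<alpha> \<beta>" and ?Q = "twist A P" and ?F = "twist A f"
  let ?M = "mu (Min UNIV) / 4"
  have len: "length ?xs = p + q" by (rule length_op_list[OF assms(8,9)])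
  have Q: "harmonic_hpoly (length ?xs) ?Q"
    using assms(7) unfolding len by (intro H_space_harmonic_hpoly) (simp add: H_lam_space_def)
  then have hQ: "hpoly (p + q) ?Q" by (simp add: harmonic_hpoly_def len)
  have LR: ?R if L: ?L
  proof -
    have "f z = 0" if z: "norm z > r" for z
    proof (cases "?Q = (\<lambda>z. 0)")
      case True
      obtain w where "z = T w" using orthogonal_transformation_surj[OF T] by (metis surjE)
      then have "P z = 0" using True tw[of P w] by (simp add: fun_eq_iff)
      then show ?thesis by (simp add: assms(6))
    next
      case False
      obtain u where u: "norm u = 1" "?Q u \<noteq> 0"
        by (rule hpoly_nonzero_on_sphere[OF hQ False])
      define \<phi> where "\<phi> = (\<lambda>t. a (sqrt t))"
      have ray: "f (sqrt t *\<^sub>R T u) = a (sqrt t) * ?Q (sqrt t *\<^sub>R u)" if "t > 0" for t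
        using that by (simp add: assms(6) tw linear_scale[OF lin] nT u(1))
      have \<phi>: "smooth_pos \<phi>"
        unfolding \<phi>_def by (rule radial_profile_smooth[OF assms(5) u(2) hQ ray])
      have F: "?F z = \<phi> ((norm z)\<^sup>2) * ?Q z" for z
        by (simp add: tw assms(6) nT \<phi>_def)
      have decay: "((\<lambda>t. of_real (exp (?M * t)) * (of_real t ^ k * \<phi> t)) \<longlongrightarrow> 0) at_top" for k
      proof -
        \<comment> \<open>The exponent \<open>2 * (k + 1)\<close> amounts to \<open>t ^ (k + 1)\<close>, one power of \<open>t\<close> more than the decay needs.\<close>
        obtain C where C: "\<And>z. norm (complex_of_real
           (norm z ^ (2 * (k + 1)) * exp (?M * (norm z)\<^sup>2)) * f z) \<le> C"
          using assms(11)[of "2 * (k + 1)"] by (auto simp: bounded_iff)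
        have bd: "norm (of_real (exp (?M * t)) * (of_real t ^ k * \<phi> t)) \<le> C / norm (?Q u) * inverse t"
          if t: "t \<ge> 1" for t
        proof -
          \<comment> \<open>For \<open>t \<ge> 1\<close> the factor \<open>sqrt t ^ (p + q)\<close> of \<open>?Q\<close> only helps.\<close>
          have q: "?Q (sqrt t *\<^sub>R u) = of_real (sqrt t) ^ (p + q) * ?Q u"
            by (rule hpoly_homogeneous[OF hQ])
          have "norm (\<phi> t) * norm (?Q u) \<le> norm (f (sqrt t *\<^sub>R T u))"
            using t mult_right_mono[of 1 "sqrt t ^ (p + q)" "norm (\<phi> t) * norm (?Q u)"]
            by (simp add: ray q \<phi>_def norm_mult norm_power one_le_power mult_ac)
          then have "(t ^ (k + 1) * exp (?M * t)) * (norm (\<phi> t) * norm (?Q u))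
              \<le> (t ^ (k + 1) * exp (?M * t)) * norm (f (sqrt t *\<^sub>R T u))"
            using t by (intro mult_left_mono) auto
          also have "\<dots> \<le> C"
          proof -
            have sq: "norm (sqrt t *\<^sub>R T u) = sqrt t" "(sqrt t)\<^sup>2 = t"
              using t u(1) by (simp_all add: nT)
            moreover have "sqrt t ^ (2 * (k + 1)) = t ^ (k + 1)"
              by (simp only: power_mult sq(2))
            moreover have "\<bar>t ^ (k + 1) * exp (?M * t)\<bar> = t ^ (k + 1) * exp (?M * t)"
              using t by simp
            ultimately show ?thesis
              using C[of "sqrt t *\<^sub>R T u"] by (simp only: norm_mult norm_of_real)
          qed
          finally have X: "(t ^ (k + 1) * exp (?M * t)) * (norm (\<phi> t) * norm (?Q u)) \<le> C" .
          have nQ: "norm (?Q u) * inverse (norm (?Q u)) = 1" "t * inverse t = 1" using u(2) t by auto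
          have "norm (of_real (exp (?M * t)) * (of_real t ^ k * \<phi> t)) = exp (?M * t) * (t ^ k * norm (\<phi> t))"
            using t by (simp add: norm_mult norm_power)
          also have "\<dots> = exp (?M * t) * (t ^ k * norm (\<phi> t))
              * (norm (?Q u) * inverse (norm (?Q u))) * (t * inverse t)"
            by (simp only: nQ mult_1_right)
          also have "\<dots> = (t ^ (k + 1) * exp (?M * t)) * (norm (\<phi> t) * norm (?Q u))
              * (inverse (norm (?Q u)) * inverse t)"
            by (simp only: power_add power_one_right mult_ac)
          also have "\<dots> \<le> C * (inverse (norm (?Q u)) * inverse t)"
            using t by (intro mult_right_mono X mult_nonneg_nonneg) auto
          finally show ?thesis by (simp only: divide_inverse mult.assoc)
        qed
        have "((\<lambda>t. C / norm (?Q u) * inverse t) \<longlongrightarrow> C / norm (?Q u) * 0) at_top"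
          by (intro tendsto_intros tendsto_inverse_0_at_top filterlim_ident)
        then show ?thesis
          using Lim_null_comparison[OF eventually_mono[OF eventually_ge_at_top bd]] by simp
      qed
      have "\<phi> ((norm z)\<^sup>2) = 0"
      proof (rule vanishing_of_decaying_profile[OF \<phi> Q F _ _ decay assms(4)])
        show "foldr wirt (map snd ?xs) ?Q 0 \<noteq> 0"
          by (rule occurs_in_foldr_wirt[OF assms(10)[OF False] count_list_op_list])
        show "c \<le> ?M" if "c \<in> set (map fst ?xs)" for c
          by (rule fst_op_list_le[OF mu that])
        show "twisted_mean mu (Pi00 (foldr twisted_deriv ?xs ?F)) s 0 = 0" if "s > r" for s
          using L[rule_format, of 0 s] that by (simp add: P_op_eq_twisted_derivs)
        show "(norm z)\<^sup>2 > r\<^sup>2" using z assms(4) by (intro power_strict_mono) auto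
      qed
      then show ?thesis by (simp add: assms(6) \<phi>_def)
    qed
    then show ?thesis
      by (intro closure_minimal) (auto simp: not_less[symmetric])
  qed
  have RL: ?L if R: ?R
  proof -
    have f0: "f z = 0" if "norm z > r" for z
      using R closure_subset[of "{z. f z \<noteq> 0}"] that by force
    have S: "open {w::(complex, 'n) vec. norm w > r}"
      by (intro open_Collect_less continuous_intros)
    have "P_op mu \<alpha> \<beta> ?F w = 0" if "norm w > r" for w
    proof -
      have "foldr twisted_deriv ?xs ?F w = foldr twisted_deriv ?xs (\<lambda>z. 0) w"
        using that by (intro twisted_derivs_cong_open[OF S]) (auto simp: tw nT f0)
      then show ?thesis by (simp add: P_op_eq_twisted_derivs twisted_derivs_zero)
    qed
    then show "\<forall>z s. s > r + norm z \<longrightarrow> twisted_mean mu (Pi00 (P_op mu \<alpha> \<beta> ?F)) s z = 0"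
      using twisted_mean_eq_0[OF _ assms(4)] by blast
  qed
  from LR RL show ?thesis by blast
qed

end
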